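(* Let $f(z)=\sum_{k=0}^n a_k z^k\in\mathbb{C}[z]$ be a polynomial of degree $n\ge 1$ with $f(0)=a_0\neq 0$. Then $$\mathcal{D}[f]\le \sqrt{2}\,\sqrt{\mathcal{H}[f]}.$$ Moreover the inequality is sharp: for every constant $c<\sqrt{2}$ there is a polynomial $f\in\mathbb{C}[z]$ with $f(0)\ne 0$ such that $\mathcal{D}[f]> c\sqrt{\mathcal{H}[f]}$.
   Context: Write the roots of $f$ (with multiplicity) as $r_je^{2\pi i\theta_j}$, $1\le j\le n$, with $r_j>0$ and $\theta_j\in\mathbb{T}=\mathbb{R}/\mathbb{Z}$. For $\alpha\le\beta<\alpha+1$, $N_f(\alpha,\beta)$ denotes the number of $j$ with $\theta_j$ lying in the arc $[\alpha,\beta]$ of $\mathbb{T}$. The discrepancy is $\mathcal{D}[f]=\max_{\alpha\le\beta<\alpha+1}\big(\frac{N_f(\alpha,\beta)}{n}-(\beta-\alpha)\big)$ and the height is $\mathcal{H}[f]=\frac1n\log\frac{\max_{|z|=1}|f(z)|}{\sqrt{|a_0a_n|}}$. *)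

theory Defs
  imports "HOL-Analysis.Analysis" "HOL-Computational_Algebra.Polynomial"
begin

text \<open>Angle of a nonzero complex number z = r e^{2 pi i theta}, as a real representative
  of theta in R/Z (taken in (-1/2, 1/2]).\<close>
definition angle_frac :: "complex \<Rightarrow> real" where
  "angle_frac z = Arg z / (2 * pi)"

text \<open>theta lies on the arc [alpha, beta] of R/Z (alpha \<le> beta < alpha + 1) iff
  the fractional part of theta - alpha is at most beta - alpha.\<close>
definition on_arc :: "real \<Rightarrow> real \<Rightarrow> real \<Rightarrow> bool" where
  "on_arc \<alpha> \<beta> \<theta> \<longleftrightarrow> frac (\<theta> - \<alpha>) \<le> \<beta> - \<alpha>"

definition root_count :: "complex poly \<Rightarrow> real \<Rightarrow> real \<Rightarrow> nat" where
  "root_count f \<alpha> \<beta> =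
     (\<Sum>z\<in>{z. poly f z = 0 \<and> on_arc \<alpha> \<beta> (angle_frac z)}. order z f)"

definition discrepancy :: "complex poly \<Rightarrow> real" where
  "discrepancy f = Sup {real (root_count f \<alpha> \<beta>) / real (degree f) - (\<beta> - \<alpha>) | \<alpha> \<beta>.
                        \<alpha> \<le> \<beta> \<and> \<beta> < \<alpha> + 1}"

definition height :: "complex poly \<Rightarrow> real" where
  "height f = (1 / real (degree f)) *
     ln (Sup ((\<lambda>z. norm (poly f z)) ` sphere 0 1) / sqrt (norm (coeff f 0 * lead_coeff f)))"

end

theory Submission
  imports Defs "HOL-Complex_Analysis.Complex_Analysis" "HOL-Real_Asymp.Real_Asymp"
    "HOL-Computational_Algebra.Fundamental_Theorem_Algebra"
begin

text \<open>
  Moving the roots radially to the unit circle only decreases the height, so let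
  \<open>\<mu>\<close> be the normalised counting measure of \<open>n\<close> points on the circle and \<open>h\<close> the
  maximum of its logarithmic potential. For every probability measure \<open>\<nu>\<close> on the circle with
  potential \<open>U\<close>, Fubini gives \<open>\<integral> U d\<mu> \<le> h\<close>; hence \<open>U \<ge> a 1\<^sub>I + b\<close> on the circle implies
  \<open>a \<mu>(I) + b \<le> h\<close>. For an arc \<open>I\<close> of length \<open>l\<close> with \<open>\<mu>(I) = l + d\<close> two choices of \<open>\<nu>\<close>
  suffice for \<open>h \<ge> d\<^sup>2/2\<close>. If \<open>l \<le> 3d/4\<close>, take the equilibrium measure of an arc complementary
  to a neighbourhood of \<open>I\<close>. If \<open>l \<ge> 3d/4\<close>, take \<open>U = A (1\<^sub>J * K - |J|)\<close>, where \<open>J\<close> is \<open>I\<close>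
  enlarged by \<open>d/4\<close> on both sides and the kernel \<open>K\<close>, supported in \<open>[-d/4, d/4]\<close>, is the
  real part of a conformal map of the disc onto a half disc.

  The constant is attained asymptotically by \<open>(z - 1)\<^sup>m\<close> times the polynomial of \<open>z = e\<^sup>2\<^sup>i\<^sup>t\<close>
  that represents the Gegenbauer polynomial \<open>C\<^sub>N\<^sup>m(cos t)\<close>, for \<open>N \<gg> m \<gg> \<surd>(N log N)\<close>: the function
  \<open>sin\<^sup>m t C\<^sub>N\<^sup>m(cos t)\<close> satisfies \<open>y'' = - Q y\<close> with \<open>Q\<close> increasing up to \<open>\<pi>/2\<close>, and an energy
  argument bounds it by its value at \<open>\<pi>/2\<close>, up to a factor linear in \<open>N + m\<close>.
\<close>

section \<open>Sums and products over multisets\<close>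

lemma has_integral_sum_mset:
  fixes f :: "'a \<Rightarrow> 'b::euclidean_space \<Rightarrow> 'c::real_normed_vector"
  assumes "\<And>x. x \<in># X \<Longrightarrow> (f x has_integral i x) A"
  shows "((\<lambda>t. \<Sum>x\<in>#X. f x t) has_integral (\<Sum>x\<in>#X. i x)) A"
  using assms by (induction X) (auto intro: has_integral_add)

lemma tendsto_sum_mset:
  fixes f :: "'a \<Rightarrow> 'b \<Rightarrow> 'c::topological_comm_monoid_add"
  assumes "\<And>x. x \<in># X \<Longrightarrow> (f x \<longlongrightarrow> l x) A"
  shows "((\<lambda>t. \<Sum>x\<in>#X. f x t) \<longlongrightarrow> (\<Sum>x\<in>#X. l x)) A"
  using assms by (induction X) (auto intro: tendsto_add)

lemma prod_mset_pos:
  fixes f :: "'a \<Rightarrow> 'b::linordered_semidom"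
  assumes "\<And>x. x \<in># X \<Longrightarrow> f x > 0"
  shows "(\<Prod>x\<in>#X. f x) > 0"
  using assms by (induction X) auto

lemma ln_prod_mset:
  fixes f :: "'a \<Rightarrow> real"
  assumes "\<And>x. x \<in># X \<Longrightarrow> f x > 0"
  shows "ln (\<Prod>x\<in>#X. f x) = (\<Sum>x\<in>#X. ln (f x))"
  using assms by (induction X) (auto simp: ln_mult_pos prod_mset_pos)

lemma prod_mset_nonneg:
  fixes f :: "'a \<Rightarrow> 'b::linordered_semidom"
  assumes "\<And>x. x \<in># X \<Longrightarrow> 0 \<le> f x"
  shows "0 \<le> (\<Prod>x\<in>#X. f x)"
  using assms by (induction X) auto

lemma prod_mset_mono_nonneg:
  fixes f g :: "'a \<Rightarrow> 'b::linordered_semidom"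
  assumes "\<And>x. x \<in># X \<Longrightarrow> 0 \<le> f x" "\<And>x. x \<in># X \<Longrightarrow> f x \<le> g x"
  shows "(\<Prod>x\<in>#X. f x) \<le> (\<Prod>x\<in>#X. g x)"
  using assms by (induction X) (auto intro!: mult_mono prod_mset_nonneg intro: order_trans)

lemma norm_prod_mset:
  fixes f :: "'a \<Rightarrow> 'b::{real_normed_div_algebra, comm_monoid_mult}"
  shows "norm (\<Prod>x\<in>#X. f x) = (\<Prod>x\<in>#X. norm (f x))"
  by (induction X) (auto simp: norm_mult)

lemma sqrt_prod_mset: "sqrt (\<Prod>x\<in>#X. f x) = (\<Prod>x\<in>#X. sqrt (f x))"
  by (induction X) (auto simp: real_sqrt_mult)

section \<open>Integrals over circles\<close>

lemma holomorphic_on_ball_shrink: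
  fixes g :: "complex \<Rightarrow> complex"
  assumes "g holomorphic_on ball a r" "\<rho> < r"
  shows "continuous_on (cball a \<rho>) g" and "g holomorphic_on ball a \<rho>"
proof -
  have "cball a \<rho> \<subseteq> ball a r" using assms(2) by auto
  then show "continuous_on (cball a \<rho>) g" and "g holomorphic_on ball a \<rho>"
    using holomorphic_on_subset[OF assms(1)] ball_subset_cball[of a \<rho>]
    by (blast intro: holomorphic_on_imp_continuous_on)+
qed

lemma Cauchy_integral_cis:
  fixes g :: "complex \<Rightarrow> complex"
  assumes "continuous_on (cball 0 \<rho>) g" "g holomorphic_on ball 0 \<rho>" "norm a < \<rho>"
  shows "((\<lambda>t. g (of_real \<rho> * cis t) * (of_real \<rho> * cis t / (of_real \<rho> * cis t - a)))
           has_integral 2 * pi * g a) {0..2*pi}"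
proof -
  have "((\<lambda>u. g u / (u - a)) has_contour_integral (2 * of_real pi * \<i> * g a)) (circlepath 0 \<rho>)"
    using assms by (intro Cauchy_integral_circlepath) auto
  then have "((\<lambda>t. g (of_real \<rho> * cis t) / (of_real \<rho> * cis t - a) * \<rho> * \<i> * cis t)
      has_integral (2 * of_real pi * \<i> * g a)) {0..2*pi}"
    by (simp add: circlepath_def has_contour_integral_part_circlepath_iff)
  from has_integral_mult_right[OF this, of "-\<i>"] show ?thesis
    by (simp add: mult_ac)
qed

lemma mean_value_cis:
  fixes g :: "complex \<Rightarrow> complex"
  assumes "continuous_on (cball 0 \<rho>) g" "g holomorphic_on ball 0 \<rho>" "0 < \<rho>"
  shows "((\<lambda>t. g (of_real \<rho> * cis t)) has_integral 2 * pi * g 0) {0..2*pi}"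
  using Cauchy_integral_cis[OF assms(1,2), of 0] assms(3) by simp

lemma mean_value_cis_interior:
  fixes g :: "complex \<Rightarrow> complex"
  assumes "g holomorphic_on ball 0 r" "0 < \<rho>" "\<rho> < r"
  shows "((\<lambda>t. g (of_real \<rho> * cis t)) has_integral 2 * pi * g 0) {0..2*pi}"
  by (intro mean_value_cis holomorphic_on_ball_shrink[OF assms(1,3)] assms(2))

lemma mean_value_cis_from:
  fixes g :: "complex \<Rightarrow> complex"
  assumes g: "continuous_on (cball 0 \<rho>) g" "g holomorphic_on ball 0 \<rho>" "0 < \<rho>"
  shows "((\<lambda>t. g (of_real \<rho> * cis t)) has_integral 2 * pi * g 0) {a..a + 2*pi}"
proof -
  have "((\<lambda>t. (g \<circ> (\<lambda>z. z * cis a)) (of_real \<rho> * cis t)) has_integral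
      2 * pi * (g \<circ> (\<lambda>z. z * cis a)) 0) {0..2*pi}"
  proof (rule mean_value_cis[OF _ _ g(3)])
    show "continuous_on (cball 0 \<rho>) (g \<circ> (\<lambda>z. z * cis a))"
      using g(1) by (intro continuous_on_compose continuous_intros)
        (auto simp: norm_mult elim!: continuous_on_subset)
    show "(g \<circ> (\<lambda>z. z * cis a)) holomorphic_on ball 0 \<rho>"
      using g(2) by (intro holomorphic_on_compose holomorphic_intros)
        (auto simp: norm_mult elim!: holomorphic_on_subset)
  qed
  then have "((\<lambda>t. g (of_real \<rho> * cis (t + a))) has_integral 2 * pi * g 0) {0..2*pi}"
    by (simp add: cis_mult mult.assoc)
  from has_integral_shift_real_ivl[OF this, of "- a"] show ?thesis by (simp add: add.commute)
qed

lemma Cauchy_integral_cis_reflected: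
  fixes g :: "complex \<Rightarrow> complex"
  assumes "continuous_on (cball 0 \<rho>) g" "g holomorphic_on ball 0 \<rho>" "0 < \<rho>"
    and a: "norm (of_real (\<rho>\<^sup>2) * a) < \<rho>"
  shows "((\<lambda>t. let w = of_real \<rho> * cis t in w * (cnj a / (1 - cnj a * w)) * cnj (g w))
           has_integral 2 * pi * cnj (g (of_real (\<rho>\<^sup>2) * a) - g 0)) {0..2*pi}"
proof -
  define w where "w t = of_real \<rho> * cis t" for t
  let ?a = "of_real (\<rho>\<^sup>2) * a"
  have "((\<lambda>t. g (w t) * (w t / (w t - ?a)) - g (w t)) has_integral
      (2 * pi * g ?a - 2 * pi * g 0)) {0..2*pi}"
    unfolding w_def by (intro has_integral_diff Cauchy_integral_cis mean_value_cis assms)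
  moreover have "g (w t) * (w t / (w t - ?a)) - g (w t) =
      g (w t) * (a * cnj (w t) / (1 - a * cnj (w t)))" for t
  proof -
    have norm: "norm (w t) = \<rho>" using assms(3) by (simp add: w_def norm_mult)
    then have ww: "of_real (\<rho>\<^sup>2) = w t * cnj (w t)" using complex_norm_square[of "w t"] by simp
    have "w t \<noteq> 0" "w t - ?a \<noteq> 0" using a norm assms(3) by auto
    have "a * cnj (w t) / (1 - a * cnj (w t)) =
        (w t * (a * cnj (w t))) / (w t * (1 - a * cnj (w t)))"
      using \<open>w t \<noteq> 0\<close> by (rule mult_divide_mult_cancel_left[symmetric])
    also have "\<dots> = ?a / (w t - ?a)" unfolding ww by (simp add: algebra_simps)
    also have "\<dots> = w t / (w t - ?a) - 1" using \<open>w t - ?a \<noteq> 0\<close> by (simp add: field_simps)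
    finally show ?thesis by (simp add: right_diff_distrib)
  qed
  ultimately have "((\<lambda>t. g (w t) * (a * cnj (w t) / (1 - a * cnj (w t)))) has_integral
      2 * pi * (g ?a - g 0)) {0..2*pi}"
    by (simp add: right_diff_distrib)
  from has_integral_linear[OF this bounded_linear_cnj] show ?thesis
    by (simp add: o_def Let_def w_def mult_ac)
qed

lemma cis_Arg_unit: "norm z = 1 \<Longrightarrow> cis (Arg z) = z"
  using cis_Arg[of z] by (cases "z = 0") (auto simp: sgn_div_norm)

lemma has_vector_derivative_mult_cis:
  assumes "(f has_field_derivative f') (at (z * cis t))"
  shows "((\<lambda>t. f (z * cis t)) has_vector_derivative \<i> * (z * cis t) * f') (at t within S)"
proof -
  have "((\<lambda>t. z * cis t) has_vector_derivative \<i> * (z * cis t)) (at t within S)"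
    unfolding has_vector_derivative_def
    by (auto intro!: derivative_eq_intros simp: algebra_simps scaleR_conv_of_real)
  from field_vector_diff_chain_within[OF this has_field_derivative_at_within[OF assms]]
  show ?thesis by (simp add: o_def)
qed

lemma cis_integral_by_parts:
  assumes f: "f holomorphic_on ball 0 r" and g: "g holomorphic_on ball 0 r" and \<rho>: "\<bar>\<rho>\<bar> < r"
  shows "((\<lambda>t. let w = of_real \<rho> * cis t in f w * cnj (w * deriv g w) - w * deriv f w * cnj (g w))
           has_integral 0) {0..2*pi}"
proof -
  define w where "w t = of_real \<rho> * cis t" for t
  have chain: "((\<lambda>t. h (w t)) has_vector_derivative \<i> * w t * deriv h (w t)) (at t within S)"
    if "h holomorphic_on ball 0 r" for h t S
    unfolding w_def using that \<rho>
    by (intro has_vector_derivative_mult_cis holomorphic_derivI[where S = "ball 0 r"])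
       (auto simp: norm_mult)
  have "w (2*pi) = w 0" by (simp add: w_def)
  moreover have "((\<lambda>t. f (w t) * cnj (\<i> * w t * deriv g (w t)) +
        \<i> * w t * deriv f (w t) * cnj (g (w t)))
     has_integral (f (w (2*pi)) * cnj (g (w (2*pi))) - f (w 0) * cnj (g (w 0)))) {0..2*pi}"
    by (intro fundamental_theorem_of_calculus has_vector_derivative_mult chain[OF f]
          bounded_linear.has_vector_derivative[OF bounded_linear_cnj chain[OF g]]) auto
  ultimately have "((\<lambda>t. f (w t) * cnj (\<i> * w t * deriv g (w t)) +
        \<i> * w t * deriv f (w t) * cnj (g (w t)))
     has_integral 0) {0..2*pi}"
    by simp
  from has_integral_mult_right[OF this, of "\<i>"] show ?thesis
    by (simp add: Let_def w_def algebra_simps)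
qed

section \<open>Duality with measures on the circle\<close>

lemma norm_one_minus_cnj_mult:
  assumes "norm \<zeta> = 1"
  shows "norm (1 - cnj \<zeta> * w) = norm (w - \<zeta>)"
proof -
  have "\<zeta> * cnj \<zeta> = 1" using assms by (simp add: complex_norm_square[symmetric])
  then have "\<zeta> * (1 - cnj \<zeta> * w) = \<zeta> - w" by algebra
  then have "norm \<zeta> * norm (1 - cnj \<zeta> * w) = norm (\<zeta> - w)" by (metis norm_mult)
  then show ?thesis using assms by (simp add: norm_minus_commute)
qed

lemma one_minus_notin_nonpos_Reals:
  fixes z :: complex
  assumes "norm z < 1" shows "1 - z \<notin> \<real>\<^sub>\<le>\<^sub>0"
  using complex_Re_le_cmod[of z] assms by (auto simp: complex_nonpos_Reals_iff)

lemma
  assumes "norm \<zeta> = 1" "norm z < 1"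
  shows DERIV_Ln_one_minus_cnj_mult:
      "((\<lambda>z. Ln (1 - cnj \<zeta> * z)) has_field_derivative - cnj \<zeta> / (1 - cnj \<zeta> * z)) (at z)"
    and Re_Ln_one_minus_cnj_mult: "Re (Ln (1 - cnj \<zeta> * z)) = ln (norm (z - \<zeta>))"
proof -
  have slit: "1 - cnj \<zeta> * z \<notin> \<real>\<^sub>\<le>\<^sub>0"
    using assms by (intro one_minus_notin_nonpos_Reals) (simp add: norm_mult)
  then show "((\<lambda>z. Ln (1 - cnj \<zeta> * z)) has_field_derivative - cnj \<zeta> / (1 - cnj \<zeta> * z)) (at z)"
    by (auto intro!: derivative_eq_intros simp: field_simps)
  show "Re (Ln (1 - cnj \<zeta> * z)) = ln (norm (z - \<zeta>))"
    using slit by (subst Re_Ln) (auto simp: norm_one_minus_cnj_mult[OF assms(1)])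
qed

text \<open>Integration by parts turns the mean of \<open>Ln (1 - z cnj \<zeta>) cnj (z F' z)\<close> into a Cauchy integral at
  the reflected point.\<close>

lemma ln_dist_mean:
  assumes F: "F holomorphic_on ball 0 1" "F 0 = 0"
    and \<rho>: "0 < \<rho>" "\<rho> < 1" and \<zeta>: "norm \<zeta> = 1"
  shows "((\<lambda>t. let w = of_real \<rho> * cis t in ln (norm (w - \<zeta>)) * (1 - 2 * Re (w * deriv F w)))
            has_integral 2 * pi * Re (F (of_real (\<rho>\<^sup>2) * \<zeta>))) {0..2*pi}"
proof -
  define w where "w t = of_real \<rho> * cis t" for t
  define L where "L z = Ln (1 - cnj \<zeta> * z)" for z
  have norm_w: "norm (w t) < 1" for t using \<rho> by (simp add: w_def norm_mult)
  have dL: "(L has_field_derivative - cnj \<zeta> / (1 - cnj \<zeta> * z)) (at z)" if "norm z < 1" for z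
    unfolding L_def by (rule DERIV_Ln_one_minus_cnj_mult[OF \<zeta> that])
  then have holL: "L holomorphic_on ball 0 1"
    by (metis holomorphic_on_open mem_ball_0 open_ball)
  have int_L: "((\<lambda>t. L (w t)) has_integral 0) {0..2*pi}"
    using mean_value_cis_interior[OF holL \<rho>] by (simp add: w_def L_def)
  have "(\<lambda>z. L z * (z * deriv F z)) holomorphic_on ball 0 1"
    by (intro holomorphic_intros holL holomorphic_deriv F) auto
  from mean_value_cis_interior[OF this \<rho>]
  have int_LF': "((\<lambda>t. L (w t) * (w t * deriv F (w t))) has_integral 0) {0..2*pi}"
    by (simp add: w_def)
  have by_parts: "((\<lambda>t. L (w t) * cnj (w t * deriv F (w t)) - w t * deriv L (w t) * cnj (F (w t)))
      has_integral 0) {0..2*pi}"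
    using cis_integral_by_parts[OF holL F(1), of \<rho>] \<rho> by (simp add: Let_def w_def)
  have "norm (of_real (\<rho>\<^sup>2) * \<zeta>) < \<rho>"
    using \<rho> \<zeta> by (simp add: norm_mult power2_eq_square)
  from has_integral_neg[OF Cauchy_integral_cis_reflected[OF
      holomorphic_on_ball_shrink[OF F(1) \<rho>(2)] \<rho>(1) this]]
  have int_L'F: "((\<lambda>t. w t * deriv L (w t) * cnj (F (w t))) has_integral
      - (2 * pi * cnj (F (of_real (\<rho>\<^sup>2) * \<zeta>)))) {0..2*pi}"
    by (simp add: DERIV_imp_deriv[OF dL[OF norm_w]] F(2) Let_def flip: w_def)
  have "((\<lambda>t. L (w t) - L (w t) * (w t * deriv F (w t)) -
      (L (w t) * cnj (w t * deriv F (w t)) - w t * deriv L (w t) * cnj (F (w t))) -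
      w t * deriv L (w t) * cnj (F (w t))) has_integral
      0 - 0 - 0 - - (2 * pi * cnj (F (of_real (\<rho>\<^sup>2) * \<zeta>)))) {0..2*pi}"
    by (intro has_integral_diff int_L int_LF' by_parts int_L'F)
  from has_integral_linear[OF this bounded_linear_Re]
  have "((\<lambda>t. Re (L (w t)) * (1 - 2 * Re (w t * deriv F (w t)))) has_integral
      2 * pi * Re (F (of_real (\<rho>\<^sup>2) * \<zeta>))) {0..2*pi}"
    by (simp add: o_def algebra_simps)
  moreover have "Re (L (w t)) = ln (norm (w t - \<zeta>))" for t
    unfolding L_def by (rule Re_Ln_one_minus_cnj_mult[OF \<zeta> norm_w])
  ultimately show ?thesis by (simp only: Let_def flip: w_def)
qed

text \<open>A probability measure on the circle with density \<open>Re (1 - 2 z F' z)\<close> is encoded by its complex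
  logarithmic potential \<open>F\<close>.\<close>

definition circle_potential :: "(complex \<Rightarrow> complex) \<Rightarrow> bool" where
  "circle_potential F \<longleftrightarrow> continuous_on (cball 0 1) F \<and> F holomorphic_on ball 0 1 \<and> F 0 = 0 \<and>
     (\<forall>z\<in>ball 0 1. Re (z * deriv F z) \<le> 1/2)"

locale circle_points =
  fixes X :: "complex multiset" and M :: real
  assumes norm_point: "x \<in># X \<Longrightarrow> norm x = 1"
    and prod_dist_le: "norm w < 1 \<Longrightarrow> (\<Prod>x\<in>#X. norm (w - x)) \<le> M"
begin

lemma prod_dist_bound_ge_1: "M \<ge> 1"
proof -
  have "(\<Prod>x\<in>#X. norm (0 - x)) = (\<Prod>x\<in>#X. 1)"
    using norm_point by (intro arg_cong[of _ _ prod_mset] image_mset_cong) simp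
  then show ?thesis using prod_dist_le[of 0] by simp
qed

lemma sum_ln_dist_le:
  assumes "norm w < 1"
  shows "(\<Sum>x\<in>#X. ln (norm (w - x))) \<le> ln M"
proof -
  have pos: "norm (w - x) > 0" if "x \<in># X" for x using norm_point[OF that] assms by auto
  then have "(\<Sum>x\<in>#X. ln (norm (w - x))) = ln (\<Prod>x\<in>#X. norm (w - x))"
    by (simp add: ln_prod_mset)
  also have "\<dots> \<le> ln M"
    using prod_mset_pos[of X "\<lambda>x. norm (w - x)"] pos prod_dist_le[OF assms] by simp
  finally show ?thesis .
qed

lemma sum_potential_radial_le:
  assumes F: "circle_potential F" and \<rho>: "0 < \<rho>" "\<rho> < 1"
  shows "(\<Sum>x\<in>#X. Re (F (of_real (\<rho>\<^sup>2) * x))) \<le> ln M"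
proof -
  define w where "w t = of_real \<rho> * cis t" for t
  define p where "p t = 1 - 2 * Re (w t * deriv F (w t))" for t
  have norm_w: "norm (w t) < 1" for t using \<rho> by (simp add: w_def norm_mult)
  have p_nonneg: "p t \<ge> 0" for t using F norm_w[of t] by (force simp: circle_potential_def p_def)
  have "F holomorphic_on ball 0 1" using F by (simp add: circle_potential_def)
  then have hol: "(\<lambda>z. 1 - 2 * (z * deriv F z)) holomorphic_on ball 0 1"
    by (intro holomorphic_intros holomorphic_deriv) auto
  have "((\<lambda>t. 1 - 2 * (w t * deriv F (w t))) has_integral 2 * pi) {0..2*pi}"
    using mean_value_cis_interior[OF hol \<rho>] by (simp add: w_def)
  from has_integral_linear[OF this bounded_linear_Re]
  have "(p has_integral 2 * pi) {0..2*pi}" by (simp add: o_def p_def[abs_def])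
  then have mass: "((\<lambda>t. ln M * p t) has_integral ln M * (2 * pi)) {0..2*pi}"
    by (rule has_integral_mult_right)
  have "((\<lambda>t. \<Sum>x\<in>#X. ln (norm (w t - x)) * p t) has_integral
      (\<Sum>x\<in>#X. 2 * pi * Re (F (of_real (\<rho>\<^sup>2) * x)))) {0..2*pi}"
    using F ln_dist_mean[OF _ _ \<rho> norm_point]
    by (intro has_integral_sum_mset) (simp add: circle_potential_def Let_def w_def p_def)
  then have "(\<Sum>x\<in>#X. 2 * pi * Re (F (of_real (\<rho>\<^sup>2) * x))) \<le> ln M * (2 * pi)"
  proof (rule has_integral_le[OF _ mass])
    fix t :: real
    show "(\<Sum>x\<in>#X. ln (norm (w t - x)) * p t) \<le> ln M * p t"
      using mult_right_mono[OF sum_ln_dist_le[OF norm_w[of t]] p_nonneg[of t]]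
      by (simp only: sum_mset_distrib_right)
  qed
  then have "2 * pi * (\<Sum>x\<in>#X. Re (F (of_real (\<rho>\<^sup>2) * x))) \<le> ln M * (2 * pi)"
    by (simp only: sum_mset_distrib_left)
  then show ?thesis by simp
qed

lemma sum_potential_le:
  assumes F: "circle_potential F"
  shows "(\<Sum>x\<in>#X. Re (F x)) \<le> ln M"
proof -
  have "((\<lambda>\<rho>. F (of_real (\<rho>\<^sup>2) * x)) \<longlongrightarrow> F x) (at_left (1::real))" if "x \<in># X" for x
  proof -
    have "continuous_on (cball 0 1) F" using F by (simp add: circle_potential_def)
    then have "continuous_on {-1..1} (\<lambda>\<rho>. F (of_real (\<rho>\<^sup>2) * x))"
      by (rule continuous_on_compose2)
         (auto intro!: continuous_intros simp: norm_mult norm_power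
            norm_point[OF that] abs_square_le_1)
    then have "((\<lambda>\<rho>. F (of_real (\<rho>\<^sup>2) * x)) \<longlongrightarrow> F (of_real (1\<^sup>2) * x)) (at 1 within {-1..1})"
      unfolding continuous_on_def by (rule bspec) simp
    then show ?thesis by (simp add: at_within_Icc_at_left)
  qed
  then have "((\<lambda>\<rho>. \<Sum>x\<in>#X. Re (F (of_real (\<rho>\<^sup>2) * x))) \<longlongrightarrow> (\<Sum>x\<in>#X. Re (F x))) (at_left 1)"
    by (intro tendsto_sum_mset tendsto_Re)
  moreover have "eventually (\<lambda>\<rho>. (\<Sum>x\<in>#X. Re (F (of_real (\<rho>\<^sup>2) * x))) \<le> ln M) (at_left (1::real))"
    using eventually_at_left_real[OF zero_less_one]
    by eventually_elim (use sum_potential_radial_le[OF F] in simp)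
  ultimately show ?thesis by (rule tendsto_upperbound) simp
qed

lemma arc_potential_bound:
  assumes "circle_potential F"
    and "\<And>z. norm z = 1 \<Longrightarrow> b \<le> Re (F z)"
    and "\<And>z. z \<in> I \<Longrightarrow> a + b \<le> Re (F z)"
  shows "a * size (filter_mset (\<lambda>x. x \<in> I) X) + b * size X \<le> ln M"
proof -
  have "a * size (filter_mset (\<lambda>x. x \<in> I) X) + b * size X = (\<Sum>x\<in>#X. (if x \<in> I then a else 0) + b)"
    by (induction X) (auto simp: algebra_simps)
  also have "\<dots> \<le> (\<Sum>x\<in>#X. Re (F x))"
    using assms(2,3) norm_point by (intro sum_mset_mono) auto
  also have "\<dots> \<le> ln M" by (rule sum_potential_le[OF assms(1)])
  finally show ?thesis .
qed

end

section \<open>A square root with a cut along an arc\<close>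

lemma isCont_csqrt_0: "isCont csqrt 0"
proof -
  have "((\<lambda>z::complex. sqrt (norm z)) \<longlongrightarrow> sqrt (norm (0::complex))) (at 0)"
    by (intro tendsto_intros)
  then have "((\<lambda>z. norm (csqrt z)) \<longlongrightarrow> 0) (at 0)" by simp
  then show ?thesis unfolding isCont_def csqrt_0 by (rule tendsto_norm_zero_cancel)
qed

lemma continuous_on_csqrt:
  assumes "S \<inter> \<real>\<^sub>\<le>\<^sub>0 \<subseteq> {0}"
  shows "continuous_on S csqrt"
proof (rule continuous_at_imp_continuous_on, rule ballI)
  fix z assume "z \<in> S"
  then show "isCont csqrt z"
    using assms isCont_csqrt_0 continuous_at_csqrt[of z] by (cases "z = 0") blast+
qed

lemma abs_Im_csqrt_less_Re_csqrt:
  assumes "Re z > 0"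
  shows "\<bar>Im (csqrt z)\<bar> < Re (csqrt z)"
proof -
  have "Re ((csqrt z)\<^sup>2) > 0" using assms by simp
  then have "\<bar>Im (csqrt z)\<bar>\<^sup>2 < (Re (csqrt z))\<^sup>2" by (simp only: Re_power2 power2_abs)
  moreover have "Re (csqrt z) \<ge> 0" using csqrt_principal[of z] by auto
  ultimately show ?thesis by (rule power_less_imp_less_base)
qed

lemma Re_csqrt_mult_cnj_csqrt_pos:
  assumes "Re a > 0" "Re b > 0"
  shows "Re (csqrt a * cnj (csqrt b)) > 0"
proof -
  have "\<bar>Im (csqrt a)\<bar> * \<bar>Im (csqrt b)\<bar> < Re (csqrt a) * Re (csqrt b)"
    using assms by (intro mult_strict_mono' abs_Im_csqrt_less_Re_csqrt) auto
  then have "\<bar>Im (csqrt a) * Im (csqrt b)\<bar> < Re (csqrt a) * Re (csqrt b)" by (simp add: abs_mult)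
  then show ?thesis by simp
qed

lemma inner_complex_mult: "(c * x) \<bullet> (c * y) = (norm c)\<^sup>2 * (x \<bullet> y)" for c x y :: complex
  unfolding inner_complex_def cmod_power2 by (simp add: power2_eq_square algebra_simps)

lemma Re_divide_eq_inner: "Re (x / y) = (y \<bullet> x) / (norm y)\<^sup>2"
  by (simp add: Re_divide inner_complex_def cmod_power2 mult.commute)

lemma norm_diff_le_norm_add:
  fixes a b :: "'a::real_inner"
  assumes "0 \<le> a \<bullet> b"
  shows "norm (a - b) \<le> norm (a + b)"
  using assms by (simp add: norm_le inner_diff inner_add inner_commute)

definition gap_factor :: "real \<Rightarrow> complex \<Rightarrow> complex" where
  "gap_factor \<phi> z = csqrt (1 - z * cis \<phi>)"

text \<open>A branch of \<open>\<surd>(1 - 2 z cos \<phi> + z\<^sup>2)\<close> that is continuous on the closed disc.\<close>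

definition gap_sqrt :: "real \<Rightarrow> complex \<Rightarrow> complex" where
  "gap_sqrt \<phi> z = gap_factor \<phi> z * gap_factor (- \<phi>) z"

lemma Re_one_minus_mult_cis:
  "norm z \<le> 1 \<Longrightarrow> Re (1 - z * cis \<phi>) \<ge> 0"
  "norm z < 1 \<Longrightarrow> Re (1 - z * cis \<phi>) > 0"
  using complex_Re_le_cmod[of "z * cis \<phi>"] by (simp_all add: norm_mult)

lemma gap_factor_power2 [simp]: "(gap_factor \<phi> z)\<^sup>2 = 1 - z * cis \<phi>"
  by (simp add: gap_factor_def)

lemma cnj_gap_factor:
  assumes "norm z \<le> 1"
  shows "gap_factor (- \<phi>) (cnj z) = cnj (gap_factor \<phi> z)"
proof -
  define w where "w = 1 - z * cis \<phi>"
  have "Re w \<ge> 0" unfolding w_def by (rule Re_one_minus_mult_cis(1)[OF assms])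
  then have "csqrt (cnj w) = cnj (csqrt w)"
    using cnj_csqrt[of w] by (cases "w = 0") (auto simp: complex_nonpos_Reals_iff complex_eq_iff)
  then show ?thesis by (simp add: gap_factor_def w_def cis_cnj)
qed

lemma continuous_on_gap_factor: "continuous_on (cball 0 1) (gap_factor \<phi>)"
  unfolding gap_factor_def[abs_def]
proof (rule continuous_on_compose2[OF continuous_on_csqrt])
  show "{z. Re z \<ge> 0} \<inter> \<real>\<^sub>\<le>\<^sub>0 \<subseteq> {0}"
    by (auto simp: complex_nonpos_Reals_iff complex_eq_iff)
  show "(\<lambda>z. 1 - z * cis \<phi>) ` cball 0 1 \<subseteq> {z. Re z \<ge> 0}"
    using Re_one_minus_mult_cis(1) by fastforce
qed (intro continuous_intros)

lemma holomorphic_on_gap_factor: "gap_factor \<phi> holomorphic_on ball 0 1"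
  unfolding gap_factor_def[abs_def]
proof (intro holomorphic_intros)
  fix z :: complex assume "z \<in> ball 0 1"
  then show "1 - z * cis \<phi> \<notin> \<real>\<^sub>\<le>\<^sub>0"
    by (intro one_minus_notin_nonpos_Reals) (simp add: norm_mult)
qed

lemma gap_sqrt_0 [simp]: "gap_sqrt \<phi> 0 = 1"
  by (simp add: gap_sqrt_def gap_factor_def)

lemma gap_sqrt_minus: "gap_sqrt \<phi> (- z) = gap_sqrt (pi - \<phi>) z"
proof -
  have cis: "cis (pi - \<phi>) = - cis (- \<phi>)" "cis (- (pi - \<phi>)) = - cis \<phi>"
    by (simp_all add: complex_eq_iff cos_diff sin_diff)
  show ?thesis unfolding gap_sqrt_def gap_factor_def cis by (simp add: mult.commute)
qed

lemma cnj_gap_sqrt: "norm z \<le> 1 \<Longrightarrow> gap_sqrt \<phi> (cnj z) = cnj (gap_sqrt \<phi> z)"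
  using cnj_gap_factor[of z \<phi>] cnj_gap_factor[of z "- \<phi>"] by (simp add: gap_sqrt_def)

lemma continuous_on_gap_sqrt: "continuous_on (cball 0 1) (gap_sqrt \<phi>)"
  unfolding gap_sqrt_def[abs_def] by (intro continuous_on_mult continuous_on_gap_factor)

lemma holomorphic_on_gap_sqrt: "gap_sqrt \<phi> holomorphic_on ball 0 1"
  unfolding gap_sqrt_def[abs_def] by (intro holomorphic_on_mult holomorphic_on_gap_factor)

lemma gap_sqrt_power2: "(gap_sqrt \<phi> z)\<^sup>2 = 1 - 2 * of_real (cos \<phi>) * z + z\<^sup>2"
proof -
  have "(gap_sqrt \<phi> z)\<^sup>2 = (1 - z * cis \<phi>) * (1 - z * cis (- \<phi>))"
    by (simp add: gap_sqrt_def power_mult_distrib)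
  also have "\<dots> = 1 - z * (cis \<phi> + cis (- \<phi>)) + z\<^sup>2 * (cis \<phi> * cis (- \<phi>))"
    by (simp add: algebra_simps power2_eq_square)
  also have "cis \<phi> + cis (- \<phi>) = 2 * of_real (cos \<phi>)" by (simp add: complex_eq_iff)
  also have "cis \<phi> * cis (- \<phi>) = 1" by (simp add: cis_mult)
  finally show ?thesis by (simp add: algebra_simps)
qed

lemma gap_sqrt_power2_half_angle:
  fixes \<phi> :: real
  defines "c \<equiv> complex_of_real (cos (\<phi>/2))" and "s \<equiv> complex_of_real (sin (\<phi>/2))"
  shows "(gap_sqrt \<phi> z)\<^sup>2 = (1 + z)\<^sup>2 - 4 * c\<^sup>2 * z"
    and "(gap_sqrt \<phi> z)\<^sup>2 = c\<^sup>2 * (1 - z)\<^sup>2 + s\<^sup>2 * (1 + z)\<^sup>2"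
proof -
  have "cos \<phi> = 2 * (cos (\<phi>/2))\<^sup>2 - 1" using cos_double_cos[of "\<phi>/2"] by simp
  then have "of_real (cos \<phi>) = 2 * c\<^sup>2 - 1" by (simp add: c_def flip: of_real_power)
  then show "(gap_sqrt \<phi> z)\<^sup>2 = (1 + z)\<^sup>2 - 4 * c\<^sup>2 * z"
    using gap_sqrt_power2[of \<phi> z] by algebra
  moreover have "s\<^sup>2 = 1 - c\<^sup>2"
    unfolding s_def c_def of_real_power[symmetric] sin_squared_eq by simp
  ultimately show "(gap_sqrt \<phi> z)\<^sup>2 = c\<^sup>2 * (1 - z)\<^sup>2 + s\<^sup>2 * (1 + z)\<^sup>2"
    by algebra
qed

lemma inner_gap_sqrt_eq:
  fixes \<phi> :: real
  defines "p \<equiv> gap_factor \<phi>" and "r \<equiv> gap_factor (- \<phi>)"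
  shows "2 * cos (\<phi>/2) * (gap_sqrt \<phi> z \<bullet> (1 - z)) =
    ((norm (p z))\<^sup>2 + (norm (r z))\<^sup>2) * Re (cis (\<phi>/2) * (r z * cnj (p z)))"
    (is "_ = _ * ?R")
proof -
  have "(p z * p z) * cis (- (\<phi>/2)) = cis (- (\<phi>/2)) - z * cis (\<phi>/2)"
    "(r z * r z) * cis (\<phi>/2) = cis (\<phi>/2) - z * cis (- (\<phi>/2))"
    by (simp_all add: p_def r_def left_diff_distrib cis_mult
        mult.assoc[of z] flip: power2_eq_square)
  moreover have "complex_of_real (2 * cos (\<phi>/2)) = cis (- (\<phi>/2)) + cis (\<phi>/2)"
    by (simp add: complex_eq_iff)
  ultimately have "(2 * cos (\<phi>/2)) *\<^sub>R (1 - z) =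
      p z * (p z * cis (- (\<phi>/2))) + r z * (r z * cis (\<phi>/2))"
    unfolding scaleR_conv_of_real by algebra
  then have "2 * cos (\<phi>/2) * (gap_sqrt \<phi> z \<bullet> (1 - z)) =
      (p z * r z) \<bullet> (p z * (p z * cis (- (\<phi>/2)))) + (r z * p z) \<bullet> (r z * (r z * cis (\<phi>/2)))"
    by (metis inner_scaleR_right inner_add_right gap_sqrt_def p_def r_def mult.commute)
  moreover have "r z \<bullet> (p z * cis (- (\<phi>/2))) = ?R" "p z \<bullet> (r z * cis (\<phi>/2)) = ?R"
    by (simp_all add: inner_complex_def algebra_simps)
  ultimately show ?thesis by (simp add: inner_complex_mult distrib_right)
qed

text \<open>The square \<open>(e\<^sup>i\<^sup>\<phi> - z) (1 - e\<^sup>-\<^sup>i\<^sup>\<phi> cnj z)\<close> of the number in question has positive imaginary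
  part, so that number lies in the first or the third quadrant.\<close>

lemma Re_gap_factor_mult_cnj_pos:
  assumes \<phi>: "0 < \<phi>" "\<phi> < pi" and z: "norm z < 1"
  shows "Re (cis (\<phi>/2) * (gap_factor (- \<phi>) z * cnj (gap_factor \<phi> z))) > 0"
proof -
  let ?p = "gap_factor \<phi> z" and ?r = "gap_factor (- \<phi>) z"
  define q where "q = cis (\<phi>/2) * (?r * cnj ?p)"
  have "q\<^sup>2 = (cis \<phi> * (1 - z * cis (- \<phi>))) * cnj (1 - z * cis \<phi>)"
    by (simp add: q_def power_mult_distrib cis_mult power2_eq_square[of "cis _"]
        flip: complex_cnj_power)
  also have "cis \<phi> * (1 - z * cis (- \<phi>)) = cis \<phi> - z"
    by (simp add: right_diff_distrib cis_mult mult.left_commute[of _ z])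
  also have "cnj (1 - z * cis \<phi>) = 1 - cnj z * cis (- \<phi>)" by (simp add: cis_cnj)
  also have "(cis \<phi> - z) * (1 - cnj z * cis (- \<phi>)) = cis \<phi> - (z + cnj z) + (z * cnj z) * cis (- \<phi>)"
    using cis_mult[of \<phi> "- \<phi>"] by (simp add: algebra_simps)
  finally have "q\<^sup>2 = cis \<phi> - (z + cnj z) + of_real ((norm z)\<^sup>2) * cis (- \<phi>)"
    by (simp only: complex_norm_square)
  from arg_cong[OF this, of Im] have "Im (q\<^sup>2) = sin \<phi> * (1 - (norm z)\<^sup>2)"
    by (simp add: algebra_simps)
  moreover have "sin \<phi> > 0" using \<phi> by (intro sin_gt_zero)
  ultimately have "Im (q\<^sup>2) > 0" using z by (simp add: power_less_one_iff abs_square_less_1)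
  then have "Re q * Im q > 0" by (simp add: Im_power2 mult.commute)
  moreover have "cos (\<phi>/2) * Re q + sin (\<phi>/2) * Im q > 0"
  proof -
    have "Re (?r * cnj ?p) > 0"
      unfolding gap_factor_def by (intro Re_csqrt_mult_cnj_csqrt_pos Re_one_minus_mult_cis(2) z)
    moreover have "?r * cnj ?p = cis (- (\<phi>/2)) * q" by (simp add: q_def cis_mult flip: mult.assoc)
    ultimately show ?thesis by simp
  qed
  moreover have "cos (\<phi>/2) > 0" "sin (\<phi>/2) > 0"
    using \<phi> by (auto intro!: cos_gt_zero_pi sin_gt_zero)
  ultimately show ?thesis unfolding q_def[symmetric]
    by (smt (verit) mult_nonneg_nonpos zero_less_mult_iff)
qed

lemma inner_gap_sqrt_pos:
  assumes \<phi>: "0 < \<phi>" "\<phi> < pi" and z: "norm z < 1"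
  shows "gap_sqrt \<phi> z \<bullet> (1 - z) > 0"
proof -
  have "gap_factor \<phi> z \<noteq> 0" using Re_gap_factor_mult_cnj_pos[OF assms] by auto
  then have "(norm (gap_factor \<phi> z))\<^sup>2 + (norm (gap_factor (- \<phi>) z))\<^sup>2 > 0"
    by (simp add: add_pos_nonneg)
  then have "2 * cos (\<phi>/2) * (gap_sqrt \<phi> z \<bullet> (1 - z)) > 0"
    unfolding inner_gap_sqrt_eq by (intro mult_pos_pos Re_gap_factor_mult_cnj_pos assms)
  moreover have "cos (\<phi>/2) > 0" using \<phi> by (intro cos_gt_zero_pi) auto
  ultimately show ?thesis by (simp add: zero_less_mult_iff)
qed

lemma inner_gap_sqrt_nonneg:
  assumes \<phi>: "0 < \<phi>" "\<phi> < pi" and z: "norm z \<le> 1"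
  shows "gap_sqrt \<phi> z \<bullet> (1 - z) \<ge> 0" and "gap_sqrt \<phi> z \<bullet> (1 + z) \<ge> 0"
proof -
  have nonneg: "gap_sqrt \<psi> w \<bullet> (1 - w) \<ge> 0" if "0 < \<psi>" "\<psi> < pi" "norm w \<le> 1" for \<psi> w
  proof (rule continuous_ge_on_closure[where S = "ball 0 1" and f = "\<lambda>w. gap_sqrt \<psi> w \<bullet> (1 - w)"])
    show "continuous_on (closure (ball 0 1)) (\<lambda>w. gap_sqrt \<psi> w \<bullet> (1 - w))"
      using continuous_on_gap_sqrt by (auto intro!: continuous_intros)
  qed (use that inner_gap_sqrt_pos in \<open>auto intro: less_imp_le\<close>)
  show "gap_sqrt \<phi> z \<bullet> (1 - z) \<ge> 0" by (rule nonneg[OF \<phi> z])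
  have "gap_sqrt (pi - \<phi>) (- z) \<bullet> (1 - (- z)) \<ge> 0" by (rule nonneg) (use \<phi> z in auto)
  then show "gap_sqrt \<phi> z \<bullet> (1 + z) \<ge> 0" by (simp add: gap_sqrt_minus)
qed

lemma DERIV_gap_sqrt:
  assumes \<phi>: "0 < \<phi>" "\<phi> < pi" and z: "norm z < 1"
  shows "(gap_sqrt \<phi> has_field_derivative (z - of_real (cos \<phi>)) / gap_sqrt \<phi> z) (at z)"
proof -
  let ?g' = "deriv (gap_sqrt \<phi>) z"
  have "(gap_sqrt \<phi> has_field_derivative ?g') (at z)"
    using holomorphic_on_gap_sqrt z by (intro holomorphic_derivI[where S = "ball 0 1"]) auto
  moreover from DERIV_power[OF this, of 2]
  have "((\<lambda>z. 1 - 2 * of_real (cos \<phi>) * z + z\<^sup>2) has_field_derivative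
      2 * (gap_sqrt \<phi> z * ?g')) (at z)"
    unfolding gap_sqrt_power2 by (simp add: mult_ac)
  moreover have "((\<lambda>z. 1 - 2 * of_real (cos \<phi>) * z + z\<^sup>2) has_field_derivative
      2 * (z - of_real (cos \<phi>))) (at z)"
    by (auto intro!: derivative_eq_intros simp: algebra_simps)
  ultimately have "2 * (gap_sqrt \<phi> z * ?g') = 2 * (z - of_real (cos \<phi>))"
    using DERIV_unique by blast
  then have "gap_sqrt \<phi> z * ?g' = z - of_real (cos \<phi>)" by (metis mult_cancel_left zero_neq_numeral)
  moreover have "gap_sqrt \<phi> z \<noteq> 0" using inner_gap_sqrt_pos[OF assms] by auto
  ultimately have "?g' = (z - of_real (cos \<phi>)) / gap_sqrt \<phi> z" by (simp add: field_simps)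
  then show ?thesis using \<open>(gap_sqrt \<phi> has_field_derivative ?g') (at z)\<close> by simp
qed

section \<open>The equilibrium measure of an arc\<close>

text \<open>The exponential of the complex potential of the equilibrium measure of the arc
  \<open>|arg z| \<ge> \<phi>\<close>, whose capacity is \<open>cos (\<phi>/2)\<close>.\<close>

definition gap_fun :: "real \<Rightarrow> complex \<Rightarrow> complex" where
  "gap_fun \<phi> z = (1 + z + gap_sqrt \<phi> z) / 2"

definition arc_equilibrium_potential :: "real \<Rightarrow> complex \<Rightarrow> complex" where
  "arc_equilibrium_potential \<phi> z = Ln (gap_fun \<phi> z)"

context
  fixes \<phi> :: real
  assumes \<phi>: "0 < \<phi>" "\<phi> < pi"
begin

private lemma cos_half_pos: "cos (\<phi>/2) > 0"
  using \<phi> by (intro cos_gt_zero_pi) auto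

lemma gap_fun_quadratic:
  "(gap_fun \<phi> z)\<^sup>2 + (of_real (cos (\<phi>/2)))\<^sup>2 * z = (1 + z) * gap_fun \<phi> z"
proof -
  have "gap_sqrt \<phi> z = 2 * gap_fun \<phi> z - (1 + z)" by (simp add: gap_fun_def add_divide_distrib)
  then show ?thesis using gap_sqrt_power2_half_angle(1)[of \<phi> z] by algebra
qed

lemma norm_gap_fun_ge:
  assumes "norm z \<le> 1"
  shows "cos (\<phi>/2) * sqrt (norm z) \<le> norm (gap_fun \<phi> z)"
proof (rule power2_le_imp_le)
  let ?E = "gap_fun \<phi> z" and ?E' = "(1 + z - gap_sqrt \<phi> z) / 2"
  have "?E * ?E' = (of_real (cos (\<phi>/2)))\<^sup>2 * z"
    using gap_sqrt_power2_half_angle(1)[of \<phi> z]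
    by (simp add: gap_fun_def algebra_simps power2_eq_square)
  then have "(cos (\<phi>/2) * sqrt (norm z))\<^sup>2 = norm ?E * norm ?E'"
    using norm_mult[of ?E ?E'] by (simp add: power_mult_distrib norm_mult norm_power)
  also have "norm ?E' \<le> norm ?E"
    using norm_diff_le_norm_add[of "1 + z" "gap_sqrt \<phi> z"] inner_gap_sqrt_nonneg(2)[OF \<phi> assms]
    by (simp add: gap_fun_def norm_divide inner_commute)
  finally show "(cos (\<phi>/2) * sqrt (norm z))\<^sup>2 \<le> (norm ?E)\<^sup>2"
    by (simp add: power2_eq_square mult_left_mono)
qed simp

lemma gap_fun_notin_nonpos_Reals:
  assumes "norm z \<le> 1"
  shows "gap_fun \<phi> z \<notin> \<real>\<^sub>\<le>\<^sub>0"
proof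
  assume "gap_fun \<phi> z \<in> \<real>\<^sub>\<le>\<^sub>0"
  then obtain x where x: "gap_fun \<phi> z = - of_real x" "x \<ge> 0"
    by (metis add.inverse_inverse neg_0_le_iff_le nonpos_Reals_cases of_real_minus)
  define c where "c = cos (\<phi>/2)"
  have c_pos: "c > 0" unfolding c_def by (rule cos_half_pos)
  have zx: "z * of_real (c\<^sup>2 + x) = - of_real (x * (1 + x))"
    using gap_fun_quadratic[of z] by (simp add: x c_def algebra_simps power2_eq_square)
  have "x > 0"
  proof (rule ccontr)
    assume "\<not> x > 0"
    with x have "z = 0" "gap_fun \<phi> z = 0" using zx c_pos by auto
    then show False by (simp add: gap_fun_def)
  qed
  have norm: "norm z * (c\<^sup>2 + x) = x * (1 + x)"
    using arg_cong[OF zx, of norm] x(2)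
    by (simp only: norm_mult norm_minus_cancel norm_of_real) simp
  have "(c * sqrt (norm z))\<^sup>2 \<le> x\<^sup>2"
    using norm_gap_fun_ge[OF assms] c_pos by (intro power_mono) (auto simp: x c_def)
  then have "c\<^sup>2 * (norm z * (c\<^sup>2 + x)) \<le> x\<^sup>2 * (c\<^sup>2 + x)"
    using x(2) by (simp add: power_mult_distrib mult_right_mono flip: mult.assoc)
  then have "x * (c\<^sup>2 * (1 + x)) \<le> x * (x * (c\<^sup>2 + x))"
    unfolding norm by (simp add: power2_eq_square mult_ac)
  then have "c\<^sup>2 \<le> x\<^sup>2" using \<open>x > 0\<close> by (simp add: power2_eq_square algebra_simps)
  moreover have "norm z * (c\<^sup>2 + x) \<le> 1 * (c\<^sup>2 + x)" using assms x(2) by (intro mult_right_mono) auto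
  then have "x\<^sup>2 \<le> c\<^sup>2" unfolding norm by (simp add: power2_eq_square algebra_simps)
  ultimately have "x = c" using c_pos x(2) by (simp add: power2_eq_iff_nonneg)
  then have "(z + 1) * of_real (c * (1 + c)) = 0"
    using zx by (simp add: power2_eq_square algebra_simps)
  moreover have "c * (1 + c) \<noteq> 0" using c_pos by simp
  ultimately have "z = - 1" by (simp add: add_eq_0_iff2 del: of_real_mult)
  then have "gap_sqrt \<phi> z = - of_real (2 * x)" using x(1) by (simp add: gap_fun_def field_simps)
  then show False
    using inner_gap_sqrt_nonneg(1)[OF \<phi> assms] \<open>x > 0\<close> by (simp add: \<open>z = - 1\<close> inner_complex_def)
qed

lemma DERIV_arc_equilibrium_potential:
  assumes z: "norm z < 1"
  shows "(arc_equilibrium_potential \<phi> has_field_derivative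
      (1 + (z - of_real (cos \<phi>)) / gap_sqrt \<phi> z) / 2 / gap_fun \<phi> z) (at z)"
proof -
  have "(gap_fun \<phi> has_field_derivative (1 + (z - of_real (cos \<phi>)) / gap_sqrt \<phi> z) / 2) (at z)"
    unfolding gap_fun_def[abs_def] by (auto intro!: derivative_eq_intros DERIV_gap_sqrt[OF \<phi> z])
  moreover have "gap_fun \<phi> z \<notin> \<real>\<^sub>\<le>\<^sub>0" using gap_fun_notin_nonpos_Reals z by simp
  ultimately show ?thesis
    unfolding arc_equilibrium_potential_def[abs_def] divide_inverse[of _ "gap_fun \<phi> z"]
      mult.commute[of _ "inverse _"]
    by (intro DERIV_chain2[OF has_field_derivative_Ln])
qed

lemma arc_equilibrium_density:
  assumes z: "norm z < 1"
  shows "1 - 2 * (z * deriv (arc_equilibrium_potential \<phi>) z) = (1 - z) / gap_sqrt \<phi> z"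
proof -
  define g where "g = gap_sqrt \<phi> z"
  define E where "E = gap_fun \<phi> z"
  define F' where "F' = deriv (arc_equilibrium_potential \<phi>) z"
  have g_nonzero: "g \<noteq> 0" using inner_gap_sqrt_pos[OF \<phi> z] by (auto simp: g_def)
  have E_nonzero: "E \<noteq> 0" using gap_fun_notin_nonpos_Reals[of z] z by (auto simp: E_def)
  have dF: "2 * g * E * F' = g + (z - of_real (cos \<phi>))"
  proof -
    have "F' = (1 + (z - of_real (cos \<phi>)) / g) / 2 / E"
      using DERIV_imp_deriv[OF DERIV_arc_equilibrium_potential[OF z]]
      by (simp only: F'_def g_def E_def)
    then have "2 * g * E * F' = g * (1 + (z - of_real (cos \<phi>)) / g)" using E_nonzero by simp
    then show ?thesis using g_nonzero by (simp add: distrib_left)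
  qed
  have two_E: "2 * E = 1 + z + g" by (simp add: E_def gap_fun_def g_def)
  have g_power2: "g\<^sup>2 = 1 - 2 * of_real (cos \<phi>) * z + z\<^sup>2" unfolding g_def by (rule gap_sqrt_power2)
  have "2 * E * (g * (1 - 2 * (z * F'))) = g * (2 * E) - 2 * z * (2 * g * E * F')"
    by (simp add: algebra_simps)
  also have "\<dots> = (1 - z) * (1 + z + g)"
    unfolding dF two_E using g_power2 by (simp add: algebra_simps power2_eq_square)
  finally have "2 * E * (g * (1 - 2 * (z * F'))) = 2 * E * (1 - z)"
    unfolding two_E by (simp only: mult.commute)
  then have "g * (1 - 2 * (z * F')) = 1 - z" using E_nonzero by simp
  then show ?thesis using g_nonzero by (simp add: F'_def g_def eq_divide_eq mult.commute)
qed

lemma circle_potential_arc_equilibrium: "circle_potential (arc_equilibrium_potential \<phi>)"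
proof -
  have "arc_equilibrium_potential \<phi> 0 = 0"
    by (simp add: arc_equilibrium_potential_def gap_fun_def)
  moreover have "continuous_on (cball 0 1) (arc_equilibrium_potential \<phi>)"
    unfolding arc_equilibrium_potential_def[abs_def]
  proof (rule continuous_on_Ln')
    show "continuous_on (cball 0 1) (gap_fun \<phi>)"
      unfolding gap_fun_def[abs_def] by (auto intro!: continuous_intros continuous_on_gap_sqrt)
  qed (use gap_fun_notin_nonpos_Reals in auto)
  moreover have "arc_equilibrium_potential \<phi> holomorphic_on ball 0 1"
    using DERIV_arc_equilibrium_potential by (metis holomorphic_on_open mem_ball_0 open_ball)
  moreover have "Re (z * deriv (arc_equilibrium_potential \<phi>) z) \<le> 1/2" if "norm z < 1" for z
  proof -
    have "Re ((1 - z) / gap_sqrt \<phi> z) > 0"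
      unfolding Re_divide_eq_inner using inner_gap_sqrt_pos[OF \<phi> that]
      by (intro divide_pos_pos) auto
    then have "Re (1 - 2 * (z * deriv (arc_equilibrium_potential \<phi>) z)) > 0"
      by (simp only: arc_equilibrium_density[OF that])
    then show ?thesis by simp
  qed
  ultimately show ?thesis by (simp add: circle_potential_def)
qed

lemma Re_arc_equilibrium_potential:
  assumes "norm z = 1"
  shows "Re (arc_equilibrium_potential \<phi> z) = ln (norm (gap_fun \<phi> z))"
  using gap_fun_notin_nonpos_Reals[of z] assms
  by (auto simp: arc_equilibrium_potential_def intro!: Re_Ln)

lemma arc_equilibrium_potential_ge:
  assumes "norm z = 1"
  shows "ln (cos (\<phi>/2)) \<le> Re (arc_equilibrium_potential \<phi> z)"
  using norm_gap_fun_ge[of z] assms cos_half_pos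
  by (auto simp: Re_arc_equilibrium_potential intro: ln_mono)

lemma arc_equilibrium_potential_ge_gap:
  assumes z: "norm z = 1" and u: "u \<ge> 0" and gap: "2 * cos (\<phi>/2) * cosh u \<le> norm (1 + z)"
  shows "u + ln (cos (\<phi>/2)) \<le> Re (arc_equilibrium_potential \<phi> z)"
proof -
  define c where "c = cos (\<phi>/2)"
  have c_pos: "c > 0" unfolding c_def by (rule cos_half_pos)
  define q where "q = norm (gap_fun \<phi> z) / c"
  have q: "q \<ge> 1" "norm (gap_fun \<phi> z) = c * q"
    using norm_gap_fun_ge[of z] z c_pos by (auto simp: q_def c_def field_simps)
  have "2 * c * cosh u * norm (gap_fun \<phi> z) \<le> norm (1 + z) * norm (gap_fun \<phi> z)"
    using gap by (intro mult_right_mono) (simp_all add: c_def)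
  also have "\<dots> \<le> (norm (gap_fun \<phi> z))\<^sup>2 + c\<^sup>2"
    using norm_triangle_ineq[of "(gap_fun \<phi> z)\<^sup>2" "(of_real c)\<^sup>2 * z"] gap_fun_quadratic[of z]
      z c_pos
    by (simp add: norm_mult norm_power c_def)
  finally have "c\<^sup>2 * (q * (2 * cosh u)) \<le> c\<^sup>2 * (q\<^sup>2 + 1)"
    by (simp add: q(2) power2_eq_square algebra_simps)
  then have "q * (2 * cosh u) \<le> q\<^sup>2 + 1" using c_pos by simp
  moreover have "2 * cosh u = exp u + exp (- u)" by (simp add: cosh_field_def)
  moreover have "exp u * exp (- u) = 1" by (simp flip: exp_add)
  ultimately have "0 \<le> (q - exp u) * (q - exp (- u))"
    by (simp add: power2_eq_square algebra_simps)
  have "exp u \<le> q"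
  proof (rule ccontr)
    assume "\<not> exp u \<le> q"
    with \<open>0 \<le> (q - exp u) * (q - exp (- u))\<close> have "q \<le> exp (- u)" by (simp add: zero_le_mult_iff)
    then have "1 \<le> exp (- u)" using q(1) by linarith
    then have "u = 0" using u by simp
    then show False using \<open>\<not> exp u \<le> q\<close> q(1) by simp
  qed
  then have "c * exp u \<le> norm (gap_fun \<phi> z)" using c_pos q(2) by simp
  then have "ln (c * exp u) \<le> ln (norm (gap_fun \<phi> z))" using c_pos by (intro ln_mono) auto
  then show ?thesis using c_pos by (simp add: Re_arc_equilibrium_potential[OF z] ln_mult c_def)
qed

end

lemma one_plus_cis: "1 + cis t = 2 * of_real (cos (t/2)) * cis (t/2)"
proof -
  have "2 * of_real (cos (t/2)) = cis (t/2) + cis (- (t/2))" by (simp add: complex_eq_iff)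
  then show ?thesis by (simp only: distrib_right cis_mult) simp
qed

lemma one_minus_cis: "1 - cis t = - 2 * \<i> * of_real (sin (t/2)) * cis (t/2)"
proof -
  have "- 2 * \<i> * of_real (sin (t/2)) = cis (- (t/2)) - cis (t/2)" by (simp add: complex_eq_iff)
  then show ?thesis by (simp only: left_diff_distrib cis_mult) simp
qed

lemma norm_one_plus_cis: "norm (1 + cis t) = 2 * \<bar>cos (t/2)\<bar>"
  by (simp add: one_plus_cis norm_mult)

lemma ln_cosh_le: "ln (cosh u) \<le> u\<^sup>2 / 2" for u :: real
proof -
  have sinh_le: "sinh x \<le> x * cosh x" if "x \<ge> 0" for x :: real
  proof -
    have "0 * cosh 0 - sinh 0 \<le> x * cosh x - sinh x"
      by (rule DERIV_nonneg_imp_nondecreasing[OF that]) (auto intro!: exI derivative_eq_intros)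
    then show ?thesis by simp
  qed
  have le_nonneg: "ln (cosh u) \<le> u\<^sup>2 / 2" if "u \<ge> 0" for u :: real
  proof -
    have "ln (cosh u) - u\<^sup>2 / 2 \<le> ln (cosh 0) - 0\<^sup>2 / 2"
    proof (rule DERIV_nonpos_imp_nonincreasing[OF that])
      fix x :: real assume "0 \<le> x"
      then show "\<exists>y. ((\<lambda>x. ln (cosh x) - x\<^sup>2 / 2) has_real_derivative y) (at x) \<and> y \<le> 0"
        using sinh_le[of x] by (intro exI[of _ "sinh x / cosh x - x"])
           (auto intro!: derivative_eq_intros simp: field_simps)
    qed
    then show ?thesis by simp
  qed
  show ?thesis using le_nonneg[of u] le_nonneg[of "- u"] by (cases "u \<ge> 0") auto
qed

lemma cosh_gt_1: "u \<noteq> 0 \<Longrightarrow> cosh u > 1" for u :: real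
  using cosh_real_ge_1[of u] cosh_real_one_iff[of u] by linarith

definition arc :: "real \<Rightarrow> complex set" where
  "arc \<tau> = cis ` {-\<tau>..\<tau>}"

lemma norm_one_plus_ge_on_arc:
  assumes "z \<in> arc (pi * l)" "l \<le> 1"
  shows "2 * cos (pi * l / 2) \<le> norm (1 + z)"
proof -
  obtain t where z_eq_cis: "z = cis t" "\<bar>t\<bar> \<le> pi * l" using assms(1) by (auto simp: arc_def)
  moreover from this have "\<bar>t\<bar> \<le> pi"
    using mult_left_mono[OF assms(2) pi_ge_zero] by linarith
  ultimately have "cos (pi * l / 2) \<le> cos \<bar>t/2\<bar>"
    using assms(2) by (subst cos_mono_le_eq) auto
  then have "cos (pi * l / 2) \<le> \<bar>cos (t/2)\<bar>" unfolding cos_abs_real by linarith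
  then show ?thesis by (simp add: z_eq_cis(1) norm_one_plus_cis)
qed

lemma cos_half_arc_pos: "0 \<le> l \<Longrightarrow> l < 1 \<Longrightarrow> cos (pi * l / 2) > 0"
  using mult_strict_left_mono[of l 1 pi]
  by (intro cos_gt_zero_pi) (auto intro: order_less_le_trans[of _ 0])

context circle_points
begin

definition arc_mass :: "real \<Rightarrow> real" where
  "arc_mass l = size (filter_mset (\<lambda>x. x \<in> arc (pi * l)) X) / size X"

lemma arc_mass_nonneg: "0 \<le> arc_mass l"
  by (simp add: arc_mass_def)

lemma arc_mass_le_1: "arc_mass l \<le> 1"
  by (simp add: arc_mass_def divide_le_eq size_filter_mset_lesseq)

lemma arc_potential_mass_bound:
  assumes "circle_potential F"
    and "\<And>z. norm z = 1 \<Longrightarrow> b \<le> Re (F z)"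
    and "\<And>z. z \<in> arc (pi * l) \<Longrightarrow> a + b \<le> Re (F z)"
  shows "size X * (a * arc_mass l + b) \<le> ln M"
proof -
  have "size X * (a * arc_mass l + b) =
      a * size (filter_mset (\<lambda>x. x \<in> arc (pi * l)) X) + b * size X"
    by (cases "X = {#}") (auto simp: arc_mass_def algebra_simps)
  then show ?thesis using arc_potential_bound[OF assms] by simp
qed

lemma arc_equilibrium_bound:
  assumes l: "l \<le> 1" and u: "0 < u" and c_bound: "0 < c" "c * cosh u \<le> cos (pi * l / 2)"
  shows "size X * (u * arc_mass l + ln c) \<le> ln M"
proof -
  have "c < c * cosh u" using c_bound(1) cosh_gt_1[of u] u by simp
  then have c_lt_1: "c < 1" using c_bound(2) cos_le_one[of "pi * l / 2"] by linarith
  define \<phi> where "\<phi> = 2 * arccos c"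
  have cos_\<phi>: "cos (\<phi>/2) = c" using c_bound(1) c_lt_1 by (simp add: \<phi>_def)
  have \<phi>: "0 < \<phi>" "\<phi> < pi"
    using arccos_less_mono[of 1 c] arccos_less_mono[of c 0] c_bound(1) c_lt_1 by (auto simp: \<phi>_def)
  show ?thesis
  proof (rule arc_potential_mass_bound[OF circle_potential_arc_equilibrium[OF \<phi>]])
    show "ln c \<le> Re (arc_equilibrium_potential \<phi> z)" if "norm z = 1" for z
      using arc_equilibrium_potential_ge[OF \<phi> that] by (simp add: cos_\<phi>)
    show "u + ln c \<le> Re (arc_equilibrium_potential \<phi> z)" if z: "z \<in> arc (pi * l)" for z
    proof -
      have "norm z = 1" using z by (auto simp: arc_def)
      moreover have "2 * c * cosh u \<le> norm (1 + z)"
        using norm_one_plus_ge_on_arc[OF z l] c_bound(2) by simp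
      ultimately show ?thesis
        using arc_equilibrium_potential_ge_gap[OF \<phi>, of z u] u by (simp add: cos_\<phi>)
    qed
  qed
qed

lemma arc_mass_bound:
  assumes l: "0 \<le> l" "l < 1"
  shows "size X * ((arc_mass l)\<^sup>2 / 2 + ln (cos (pi * l / 2))) \<le> ln M"
proof (cases "arc_mass l = 0")
  case True
  have "ln (cos (pi * l / 2)) \<le> 0" using cos_half_arc_pos[OF l] by simp
  then have "size X * ln (cos (pi * l / 2)) \<le> 0" by (simp add: mult_nonneg_nonpos)
  also have "0 \<le> ln M" using prod_dist_bound_ge_1 by simp
  finally show ?thesis by (simp add: True)
next
  case False
  define \<mu> where "\<mu> = arc_mass l"
  have \<mu>: "\<mu> > 0" using False arc_mass_nonneg[of l] by (simp add: \<mu>_def)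
  define k where "k = cos (pi * l / 2)"
  have k_pos: "0 < k" unfolding k_def by (rule cos_half_arc_pos[OF l])
  have "cosh \<mu> > 0" by (rule cosh_real_pos)
  then have "ln (k / cosh \<mu>) = ln k - ln (cosh \<mu>)" using k_pos by (simp add: ln_div)
  then have "\<mu>\<^sup>2 / 2 + ln k \<le> \<mu> * arc_mass l + ln (k / cosh \<mu>)"
    using ln_cosh_le[of \<mu>] by (simp add: \<mu>_def power2_eq_square)
  then have "size X * (\<mu>\<^sup>2 / 2 + ln k) \<le> size X * (\<mu> * arc_mass l + ln (k / cosh \<mu>))"
    by (intro mult_left_mono) auto
  also have "\<dots> \<le> ln M"
    using l \<mu> k_pos \<open>cosh \<mu> > 0\<close> by (intro arc_equilibrium_bound) (auto simp: k_def)
  finally show ?thesis by (simp only: \<mu>_def k_def)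
qed

end

section \<open>A conformal map onto a half disc\<close>

text \<open>The conformal map \<open>u\<close> of the disc onto \<open>{|u| < 1, Re u > 0}\<close> with
  \<open>1/u - u = 2 cot (\<phi>/2) (1 - z)/(1 + z)\<close>; it sends the arc \<open>|arg z| \<ge> \<phi>\<close> to the imaginary axis.\<close>

definition half_disc_map :: "real \<Rightarrow> complex \<Rightarrow> complex" where
  "half_disc_map \<phi> z =
     of_real (sin (\<phi>/2)) * (1 + z) / (of_real (cos (\<phi>/2)) * (1 - z) + gap_sqrt \<phi> z)"

lemma half_disc_map_0: "half_disc_map \<phi> 0 = of_real (tan (\<phi>/4))"
  using tan_half[of "\<phi>/4"] by (simp add: half_disc_map_def add.commute)

lemma cnj_half_disc_map:
  "norm z \<le> 1 \<Longrightarrow> half_disc_map \<phi> (cnj z) = cnj (half_disc_map \<phi> z)"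
  by (simp add: half_disc_map_def cnj_gap_sqrt)

context
  fixes \<phi> :: real
  assumes \<phi>: "0 < \<phi>" "\<phi> < pi"
begin

private lemma half_angle_pos: "cos (\<phi>/2) > 0" "sin (\<phi>/2) > 0"
  using \<phi> by (auto intro!: cos_gt_zero_pi sin_gt_zero)

lemma half_disc_map_denom_nonzero:
  assumes "norm z \<le> 1"
  shows "of_real (cos (\<phi>/2)) * (1 - z) + gap_sqrt \<phi> z \<noteq> 0"
proof
  assume "of_real (cos (\<phi>/2)) * (1 - z) + gap_sqrt \<phi> z = 0"
  then have gap_sqrt_eq: "gap_sqrt \<phi> z = - (cos (\<phi>/2) *\<^sub>R (1 - z))"
    by (simp add: scaleR_conv_of_real add_eq_0_iff2)
  then have "- (cos (\<phi>/2) * ((1 - z) \<bullet> (1 - z))) \<ge> 0"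
    using inner_gap_sqrt_nonneg(1)[OF \<phi> assms] by simp
  then have "(1 - z) \<bullet> (1 - z) \<le> 0"
    using half_angle_pos(1) by (simp add: mult_le_0_iff del: inner_eq_zero_iff)
  then have "z = 1" by (metis inner_eq_zero_iff inner_ge_zero order_antisym right_minus_eq)
  moreover have "gap_sqrt \<phi> 1 \<noteq> 0"
    using gap_sqrt_power2_half_angle(2)[of \<phi> 1] half_angle_pos(2) by auto
  ultimately show False using gap_sqrt_eq by simp
qed

lemma half_disc_map_quadratic:
  assumes "norm z \<le> 1"
  shows "of_real (sin (\<phi>/2)) * (1 + z) * (1 - (half_disc_map \<phi> z)\<^sup>2) =
         2 * of_real (cos (\<phi>/2)) * (1 - z) * half_disc_map \<phi> z"
proof -
  define s c :: complex where "s = of_real (sin (\<phi>/2))" and "c = of_real (cos (\<phi>/2))"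
  define g where "g = gap_sqrt \<phi> z"
  define D where "D = c * (1 - z) + g"
  define u where "u = half_disc_map \<phi> z"
  have D_nonzero: "D \<noteq> 0"
    using half_disc_map_denom_nonzero[OF assms] by (simp add: D_def c_def g_def)
  have "u * D = s * (1 + z)"
    using D_nonzero by (simp add: u_def half_disc_map_def D_def s_def c_def g_def)
  moreover have "g\<^sup>2 = c\<^sup>2 * (1 - z)\<^sup>2 + s\<^sup>2 * (1 + z)\<^sup>2"
    unfolding g_def s_def c_def by (rule gap_sqrt_power2_half_angle(2))
  then have "(D - c * (1 - z))\<^sup>2 = c\<^sup>2 * (1 - z)\<^sup>2 + s\<^sup>2 * (1 + z)\<^sup>2" by (simp add: D_def)
  ultimately have "(D * D) * (s * (1 + z) * (1 - u\<^sup>2)) = (D * D) * (2 * c * (1 - z) * u)"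
    by algebra
  then show ?thesis using D_nonzero by (simp add: u_def s_def c_def)
qed

lemma continuous_on_half_disc_map: "continuous_on (cball 0 1) (half_disc_map \<phi>)"
  unfolding half_disc_map_def[abs_def]
  by (intro continuous_intros continuous_on_gap_sqrt) (use half_disc_map_denom_nonzero in auto)

lemma holomorphic_on_half_disc_map: "half_disc_map \<phi> holomorphic_on ball 0 1"
  unfolding half_disc_map_def[abs_def]
  by (intro holomorphic_intros holomorphic_on_gap_sqrt) (use half_disc_map_denom_nonzero in auto)

lemma Re_half_disc_map_nonneg:
  assumes "norm z \<le> 1"
  shows "Re (half_disc_map \<phi> z) \<ge> 0"
proof -
  have "(1 - z) \<bullet> (1 + z) = 1 - (norm z)\<^sup>2"
    unfolding cmod_power2 by (simp add: inner_complex_def power2_eq_square algebra_simps)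
  moreover have "(norm z)\<^sup>2 \<le> 1" using assms by (simp add: abs_square_le_1)
  ultimately have "(cos (\<phi>/2) *\<^sub>R (1 - z) + gap_sqrt \<phi> z) \<bullet> (1 + z) \<ge> 0"
    using inner_gap_sqrt_nonneg(2)[OF \<phi> assms] half_angle_pos(1) by (simp add: inner_add_left)
  then show ?thesis
    using half_angle_pos(2)
    by (simp add: half_disc_map_def Re_divide_eq_inner scaleR_conv_of_real inner_mult_right
        flip: scaleR_conv_of_real)
qed

lemma norm_half_disc_map_le_1:
  assumes "norm z \<le> 1"
  shows "norm (half_disc_map \<phi> z) \<le> 1"
proof -
  define s c :: complex where "s = of_real (sin (\<phi>/2))" and "c = of_real (cos (\<phi>/2))"
  define D D' where "D = c * (1 - z) + gap_sqrt \<phi> z" and "D' = gap_sqrt \<phi> z - c * (1 - z)"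
  have D_pos: "norm D > 0" using half_disc_map_denom_nonzero[OF assms] by (simp add: D_def c_def)
  have "(s * (1 + z))\<^sup>2 = D * D'"
    using gap_sqrt_power2_half_angle(2)[of \<phi> z]
    by (simp add: D_def D'_def s_def c_def algebra_simps power2_eq_square)
  then have "(norm (s * (1 + z)))\<^sup>2 = norm D * norm D'" by (metis norm_mult norm_power)
  also have "norm D' \<le> norm D"
    unfolding D_def D'_def add.commute[of "c * _"]
    by (rule norm_diff_le_norm_add)
       (use inner_gap_sqrt_nonneg(1)[OF \<phi> assms] half_angle_pos
        in \<open>simp add: c_def flip: scaleR_conv_of_real\<close>)
  finally have "(norm (s * (1 + z)))\<^sup>2 \<le> (norm D)\<^sup>2" by (simp add: power2_eq_square mult_left_mono)
  then have "norm (s * (1 + z)) \<le> norm D" by (rule power2_le_imp_le) simp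
  then show ?thesis using D_pos by (simp add: half_disc_map_def D_def s_def c_def norm_divide)
qed

lemma half_disc_map_cis:
  assumes "- pi < t" "t < pi"
  defines "u \<equiv> half_disc_map \<phi> (cis t)"
  shows "u\<^sup>2 = 1 + 2 * \<i> * of_real (tan (t/2) / tan (\<phi>/2)) * u"
proof -
  define k where "k = 2 * of_real (sin (\<phi>/2) * cos (t/2)) * cis (t/2)"
  have pos: "cos (t/2) > 0" using assms by (intro cos_gt_zero_pi) auto
  then have "k \<noteq> 0" using half_angle_pos by (simp add: k_def)
  have "k * (1 - u\<^sup>2) = - (2 * \<i> * of_real (2 * cos (\<phi>/2) * sin (t/2)) * cis (t/2) * u)"
    using half_disc_map_quadratic[of "cis t"]
    by (simp add: u_def[symmetric] one_plus_cis one_minus_cis k_def mult_ac)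
  also have "cos (\<phi>/2) * sin (t/2) = tan (t/2) / tan (\<phi>/2) * (sin (\<phi>/2) * cos (t/2))"
    using pos half_angle_pos by (simp add: tan_def)
  then have "of_real (2 * cos (\<phi>/2) * sin (t/2)) * cis (t/2) = k * of_real (tan (t/2) / tan (\<phi>/2))"
    unfolding k_def by (simp only: of_real_mult of_real_numeral mult_ac)
  then have "- (2 * \<i> * of_real (2 * cos (\<phi>/2) * sin (t/2)) * cis (t/2) * u) =
      k * - (2 * \<i> * of_real (tan (t/2) / tan (\<phi>/2)) * u)"
    by (simp only: mult.assoc mult_minus_right) (simp only: mult_ac)
  finally have "1 - u\<^sup>2 = - (2 * \<i> * of_real (tan (t/2) / tan (\<phi>/2)) * u)"
    using \<open>k \<noteq> 0\<close> by (simp only: mult_cancel_left simp_thms)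
  then show ?thesis by (simp add: algebra_simps)
qed

end

context
  fixes u :: complex and \<kappa> :: real
  assumes quadratic: "u\<^sup>2 = 1 + 2 * \<i> * of_real \<kappa> * u" and norm: "norm u \<le> 1"
begin

lemma Re_quadratic_root_eq_0:
  assumes "\<bar>\<kappa>\<bar> \<ge> 1"
  shows "Re u = 0"
proof (rule ccontr)
  assume "Re u \<noteq> 0"
  moreover have "Re u * Im u = \<kappa> * Re u"
    using arg_cong[OF quadratic, of Im] by (simp add: power2_eq_square mult.commute)
  ultimately have "Im u = \<kappa>" by simp
  moreover have "(Re u)\<^sup>2 - (Im u)\<^sup>2 = 1 - 2 * \<kappa> * Im u"
    using arg_cong[OF quadratic, of Re] by (simp add: power2_eq_square)
  ultimately have "(Re u)\<^sup>2 = 1 - \<kappa>\<^sup>2" by (simp add: power2_eq_square)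
  moreover have "\<kappa>\<^sup>2 \<ge> 1" using assms abs_square_less_1[of \<kappa>] by linarith
  moreover have "(Re u)\<^sup>2 > 0" using \<open>Re u \<noteq> 0\<close> by simp
  ultimately show False by linarith
qed

lemma Im_quadratic_root_nonpos:
  assumes "\<kappa> \<le> 0"
  shows "Im u \<le> 0"
proof (rule ccontr)
  assume "\<not> Im u \<le> 0"
  moreover have "(Re u)\<^sup>2 \<le> 1"
    using abs_Re_le_cmod[of u] norm by (simp add: abs_square_le_1)
  moreover have "1 - (Re u)\<^sup>2 + (Im u)\<^sup>2 = 2 * (\<kappa> * Im u)"
    using arg_cong[OF quadratic, of Re] by (simp add: power2_eq_square)
  moreover have "\<kappa> * Im u \<le> 0"
    using assms \<open>\<not> Im u \<le> 0\<close> by (intro mult_nonpos_nonneg) auto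
  ultimately show False by (smt (verit) zero_less_power2)
qed

lemma norm_quadratic_root_le:
  assumes "\<bar>\<kappa>\<bar> \<ge> 5/2"
  shows "norm u \<le> 11/50"
proof (rule ccontr)
  \<comment> \<open>\<open>11/50\<close> exceeds the smaller root \<open>(5 - \<surd>21)/2\<close> of \<open>x\<^sup>2 - 5 x + 1\<close>\<close>
  assume "\<not> norm u \<le> 11/50"
  have "5 * norm u \<le> 2 * \<bar>\<kappa>\<bar> * norm u" using assms by (intro mult_right_mono) auto
  also have "\<dots> = norm (u\<^sup>2 - 1)" using quadratic by (simp add: norm_mult)
  also have "\<dots> \<le> (norm u)\<^sup>2 + 1" using norm_triangle_ineq4[of "u\<^sup>2" 1] by (simp add: norm_power)
  finally have "5 * norm u \<le> (norm u)\<^sup>2 + 1" .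
  moreover have "(norm u - 11/50) * (1 - norm u) \<ge> 0"
    using \<open>\<not> norm u \<le> 11/50\<close> norm by simp
  then have "(norm u)\<^sup>2 \<le> 61/50 * norm u - 11/50"
    by (simp add: field_simps power2_eq_square)
  ultimately show False
    using \<open>\<not> norm u \<le> 11/50\<close> by linarith
qed

end

lemma half_disc_map_minus_1 [simp]: "half_disc_map \<phi> (- 1) = 0"
  by (simp add: half_disc_map_def)

lemma Re_half_disc_map_eq_0:
  assumes \<phi>: "0 < \<phi>" "\<phi> < pi" and t: "\<phi> \<le> t" "t \<le> 2 * pi - \<phi>"
  shows "Re (half_disc_map \<phi> (cis t)) = 0"
proof -
  have upper: "Re (half_disc_map \<phi> (cis t)) = 0" if t: "\<phi> \<le> t" "t \<le> pi" for t
  proof (cases "t = pi")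
    case False
    have "tan (\<phi>/2) \<le> tan (t/2)" using \<phi> t False by (subst tan_mono_le_eq) auto
    moreover have "tan (\<phi>/2) > 0" using \<phi> by (intro tan_gt_zero) auto
    ultimately have "\<bar>tan (t/2) / tan (\<phi>/2)\<bar> \<ge> 1" by simp
    then show ?thesis
      using \<phi> t False
      by (intro Re_quadratic_root_eq_0[OF half_disc_map_cis[OF \<phi>]
          norm_half_disc_map_le_1[OF \<phi>]]) auto
  qed simp
  show ?thesis
  proof (cases "t \<le> pi")
    case False
    have "cis t = cnj (cis (2 * pi - t))" by (simp add: cis_cnj complex_eq_iff sin_diff cos_diff)
    then show ?thesis using upper[of "2 * pi - t"] t False by (simp add: cnj_half_disc_map)
  qed (use upper t in auto)
qed

lemma mult_tan_le_tan_mult: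
  assumes "1 \<le> a" "0 \<le> x" "a * x < pi/2"
  shows "a * tan x \<le> tan (a * x)"
proof -
  have "a * tan x - tan (a * x) \<le> a * tan 0 - tan (a * 0)"
  proof (rule DERIV_nonpos_imp_nonincreasing[OF assms(2)])
    fix y assume y_bounds: "0 \<le> y" "y \<le> x"
    then have "y \<le> a * y" "a * y \<le> a * x"
      using assms(1) mult_right_mono[of 1 a y] by (auto intro!: mult_left_mono)
    then have ay: "y \<le> a * y" "a * y < pi/2" using assms(3) by auto
    then have cos: "cos (a * y) > 0" "cos y > 0" using y_bounds by (auto intro!: cos_gt_zero_pi)
    moreover have "cos (a * y) \<le> cos y" using y_bounds ay by (intro cos_monotone_0_pi_le) auto
    ultimately have "inverse ((cos y)\<^sup>2) \<le> inverse ((cos (a * y))\<^sup>2)"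
      by (intro le_imp_inverse_le power_mono) auto
    then have "a * (inverse ((cos y)\<^sup>2) - inverse ((cos (a * y))\<^sup>2)) \<le> 0"
      using assms(1) by (intro mult_nonneg_nonpos) auto
    moreover have "((\<lambda>x. a * tan x - tan (a * x)) has_real_derivative
        a * (inverse ((cos y)\<^sup>2) - inverse ((cos (a * y))\<^sup>2))) (at y)"
      using cos by (auto intro!: derivative_eq_intros simp: algebra_simps)
    ultimately show "\<exists>d. ((\<lambda>x. a * tan x - tan (a * x)) has_real_derivative d) (at y) \<and> d \<le> 0"
      by blast
  qed
  then show ?thesis by simp
qed

lemma Im_half_disc_map_le:
  assumes \<phi>: "0 < \<phi>" "\<phi> < pi" and \<tau>: "5/2 * \<phi> \<le> \<tau>" "\<tau> < pi" and t: "\<tau> \<le> t" "t \<le> \<tau> + pi"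
  shows "Im (half_disc_map \<phi> (cis t)) \<le> 11/50"
proof -
  note norm_le_1 = norm_half_disc_map_le_1[OF \<phi>, of "cis _", simplified]
  consider (less) "t < pi" | (eq) "t = pi" | (greater) "pi < t" by linarith
  then show ?thesis
  proof cases
    case less
    have "5/2 * tan (\<phi>/2) \<le> tan (5/2 * (\<phi>/2))"
      using \<phi> \<tau> by (intro mult_tan_le_tan_mult) auto
    also have "\<dots> \<le> tan (t/2)" using \<phi> \<tau> t less by (subst tan_mono_le_eq) auto
    finally have "5/2 \<le> tan (t/2) / tan (\<phi>/2)"
      using tan_gt_zero[of "\<phi>/2"] \<phi> by (simp add: le_divide_eq)
    then have "5/2 \<le> \<bar>tan (t/2) / tan (\<phi>/2)\<bar>" by linarith
    then have "norm (half_disc_map \<phi> (cis t)) \<le> 11/50"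
      using \<phi> \<tau> t less by (intro norm_quadratic_root_le[OF half_disc_map_cis[OF \<phi>] norm_le_1]) auto
    then show ?thesis using abs_Im_le_cmod[of "half_disc_map \<phi> (cis t)"] by linarith
  next
    case eq
    then show ?thesis by simp
  next
    case greater
    have "tan (pi - t/2) > 0" using greater t \<tau> by (intro tan_gt_zero) auto
    moreover have "(t - 2 * pi) / 2 = - (pi - t/2)" by (simp add: diff_divide_distrib)
    ultimately have "tan ((t - 2 * pi) / 2) \<le> 0" by (simp only: tan_minus)
    then have "tan ((t - 2 * pi) / 2) / tan (\<phi>/2) \<le> 0"
      using tan_gt_zero[of "\<phi>/2"] \<phi> by (intro divide_nonpos_pos) auto
    then have "Im (half_disc_map \<phi> (cis (t - 2 * pi))) \<le> 0"
      using greater t \<tau>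
      by (intro Im_quadratic_root_nonpos[OF half_disc_map_cis[OF \<phi>] norm_le_1]) auto
    moreover have "cis (t - 2 * pi) = cis t" by (simp add: complex_eq_iff sin_diff cos_diff)
    ultimately show ?thesis by simp
  qed
qed

lemma Im_half_disc_map_diff_le:
  assumes \<phi>: "0 < \<phi>" "\<phi> < pi" and \<tau>: "5/2 * \<phi> \<le> \<tau>" "\<tau> < pi" and z: "norm z = 1"
  shows "Im (half_disc_map \<phi> (z * cis \<tau>)) - Im (half_disc_map \<phi> (z * cis (- \<tau>))) \<le> 61/50"
proof -
  have upper: "Im (half_disc_map \<phi> (z * cis \<tau>)) - Im (half_disc_map \<phi> (z * cis (- \<tau>))) \<le> 61/50"
    if z: "norm z = 1" and Im: "0 \<le> Im z" for z
  proof -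
    have "z * cis \<tau> = cis (\<tau> + Arg z)" by (metis cis_Arg_unit[OF z] cis_mult mult.commute)
    then have "Im (half_disc_map \<phi> (z * cis \<tau>)) \<le> 11/50"
      using Im_half_disc_map_le[OF \<phi> \<tau>, of "\<tau> + Arg z"] Im Arg_le_pi[of z]
      by (simp flip: Arg_less_0)
    moreover have "- Im (half_disc_map \<phi> (z * cis (- \<tau>))) \<le> 1"
      using norm_half_disc_map_le_1[OF \<phi>, of "z * cis (- \<tau>)"] z
        abs_Im_le_cmod[of "half_disc_map \<phi> (z * cis (- \<tau>))"] by (simp add: norm_mult)
    ultimately show ?thesis by simp
  qed
  show ?thesis
  proof (cases "Im z \<ge> 0")
    case False
    then have "Im (cnj z) \<ge> 0" by simp
    from upper[OF _ this]
    have "Im (half_disc_map \<phi> (cnj (z * cis (- \<tau>)))) -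
        Im (half_disc_map \<phi> (cnj (z * cis \<tau>))) \<le> 61/50"
      using z by (simp add: cis_cnj)
    then show ?thesis using z by (simp add: cnj_half_disc_map norm_mult del: complex_cnj_mult)
  qed (use upper z in auto)
qed

section \<open>Averages over arcs\<close>

definition arc_average :: "(complex \<Rightarrow> complex) \<Rightarrow> real \<Rightarrow> complex \<Rightarrow> complex" where
  "arc_average K \<tau> z = integral {-\<tau>..\<tau>} (\<lambda>s. K (z * cis s)) / (2 * pi)"

lemma arc_average_0: "0 \<le> \<tau> \<Longrightarrow> arc_average K \<tau> 0 = of_real (\<tau> / pi) * K 0"
  by (simp add: arc_average_def scaleR_conv_of_real)

lemma continuous_on_arc_average:
  assumes "continuous_on (cball 0 1) K"
  shows "continuous_on (cball 0 1) (arc_average K \<tau>)"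
proof -
  have "continuous_on (cball 0 1 \<times> cbox (-\<tau>) \<tau>) (\<lambda>(z, s). K (z * cis s))"
    unfolding split_beta'
    by (rule continuous_on_compose2[OF assms]) (auto intro!: continuous_intros simp: norm_mult)
  from integral_continuous_on_param[OF this] show ?thesis
    unfolding arc_average_def[abs_def] by (intro continuous_on_divide) auto
qed

lemma arc_average_integrable:
  fixes K :: "complex \<Rightarrow> complex"
  assumes "continuous_on (cball 0 1) K" "norm z \<le> 1"
  shows "(\<lambda>s. K (z * cis s)) integrable_on {a..b}"
  by (rule integrable_continuous_real, rule continuous_on_compose2[OF assms(1)])
     (use assms(2) in \<open>auto intro!: continuous_intros simp: norm_mult\<close>)

lemma DERIV_arc_average:
  assumes K: "K holomorphic_on ball 0 1" and z: "norm z < 1"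
  shows "(arc_average K \<tau> has_field_derivative
      integral {-\<tau>..\<tau>} (\<lambda>s. deriv K (z * cis s) * cis s) / (2 * pi)) (at z)"
proof -
  have "((\<lambda>z. integral (cbox (-\<tau>) \<tau>) (\<lambda>s. K (z * cis s))) has_field_derivative
      integral (cbox (-\<tau>) \<tau>) (\<lambda>s. deriv K (z * cis s) * cis s)) (at z within ball 0 1)"
  proof (rule leibniz_rule_field_derivative)
    show "((\<lambda>z. K (z * cis s)) has_field_derivative
        deriv K (z * cis s) * cis s) (at z within ball 0 1)"
      if "z \<in> ball 0 1" for z s
      by (rule has_field_derivative_at_within, rule DERIV_chain2[OF holomorphic_derivI[OF K]])
         (use that in \<open>auto intro!: derivative_eq_intros simp: norm_mult\<close>)
    show "(\<lambda>s. K (z * cis s)) integrable_on cbox (-\<tau>) \<tau>" if "z \<in> ball 0 1" for z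
      using that
      by (intro integrable_continuous
          continuous_on_compose2[OF holomorphic_on_imp_continuous_on[OF K]])
         (auto intro!: continuous_intros simp: norm_mult)
    have "continuous_on (ball 0 1 \<times> cbox (-\<tau>) \<tau>) (\<lambda>(z, s). deriv K (z * cis s))"
      unfolding split_beta'
      by (rule continuous_on_compose2[OF
          holomorphic_on_imp_continuous_on[OF holomorphic_deriv[OF K]]])
         (auto intro!: continuous_intros simp: norm_mult)
    then show "continuous_on (ball 0 1 \<times> cbox (-\<tau>) \<tau>) (\<lambda>(z, s). deriv K (z * cis s) * cis s)"
      unfolding split_beta' by (intro continuous_intros)
  qed (use z in auto)
  then have "((\<lambda>z. integral {-\<tau>..\<tau>} (\<lambda>s. K (z * cis s))) has_field_derivative
      integral {-\<tau>..\<tau>} (\<lambda>s. deriv K (z * cis s) * cis s)) (at z)"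
    using z by (simp add: at_within_open[of z "ball 0 1"])
  then show ?thesis unfolding arc_average_def[abs_def] by (rule DERIV_cdivide)
qed

lemma mult_deriv_arc_average:
  assumes K: "K holomorphic_on ball 0 1" and z: "norm z < 1" and \<tau>: "0 \<le> \<tau>"
  shows "z * deriv (arc_average K \<tau>) z = (K (z * cis \<tau>) - K (z * cis (- \<tau>))) / (2 * pi * \<i>)"
proof -
  have "((\<lambda>s. \<i> * (z * cis s) * deriv K (z * cis s)) has_integral
      (K (z * cis \<tau>) - K (z * cis (- \<tau>)))) {-\<tau>..\<tau>}"
    using z \<tau>
    by (intro fundamental_theorem_of_calculus
        has_vector_derivative_mult_cis holomorphic_derivI[OF K])
       (auto simp: norm_mult)
  moreover have "(\<lambda>s. \<i> * (z * cis s) * deriv K (z * cis s)) =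
      (\<lambda>s. \<i> * z * (deriv K (z * cis s) * cis s))"
    by (simp add: mult_ac)
  ultimately have "\<i> * z * integral {-\<tau>..\<tau>} (\<lambda>s. deriv K (z * cis s) * cis s) =
      K (z * cis \<tau>) - K (z * cis (- \<tau>))"
    by (metis integral_mult_right integral_unique)
  then show ?thesis
    unfolding DERIV_imp_deriv[OF DERIV_arc_average[OF K z]] by (simp add: field_simps)
qed

lemma Re_arc_average_cis:
  assumes "continuous_on (cball 0 1) K"
  shows "Re (arc_average K \<tau> (cis t)) = integral {t-\<tau>..t+\<tau>} (\<lambda>s. Re (K (cis s))) / (2 * pi)"
proof -
  have int: "(\<lambda>s. K (cis t * cis s)) integrable_on {-\<tau>..\<tau>}"
    by (rule arc_average_integrable[OF assms]) simp
  have "Re (arc_average K \<tau> (cis t)) = integral {-\<tau>..\<tau>} (\<lambda>s. Re (K (cis t * cis s))) / (2 * pi)"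
    unfolding arc_average_def using integral_linear[OF int bounded_linear_Re] by (simp add: o_def)
  also have "integral {-\<tau>..\<tau>} (\<lambda>s. Re (K (cis t * cis s))) =
      integral {t-\<tau>..t+\<tau>} (\<lambda>s. Re (K (cis s)))"
    using integral_shift_real_ivl[of "t-\<tau>" t "t+\<tau>" "\<lambda>s. Re (K (cis s))"]
    by (simp add: cis_mult add.commute)
  finally show ?thesis .
qed

context
  fixes K :: "complex \<Rightarrow> complex"
  assumes cont: "continuous_on (cball 0 1) K" and hol: "K holomorphic_on ball 0 1" and K0: "K 0 = 1"
begin

lemma Re_mult_deriv_arc_average_le:
  assumes \<tau>: "0 \<le> \<tau>" and z: "norm z < 1"
    and oscillation: "\<And>z. norm z = 1 \<Longrightarrow> a * (Im (K (z * cis \<tau>)) - Im (K (z * cis (- \<tau>)))) \<le> pi"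
  shows "Re (of_real a * (z * deriv (arc_average K \<tau>) z)) \<le> 1/2"
proof -
  define D where "D z = of_real a * ((K (z * cis \<tau>) - K (z * cis (- \<tau>))) / (2 * pi * \<i>))" for z
  have Re_D: "Re (D z) = a * (Im (K (z * cis \<tau>)) - Im (K (z * cis (- \<tau>)))) / (2 * pi)" for z
    by (simp add: D_def Re_divide power2_eq_square field_simps)
  have "Re (D z) \<le> 1/2"
  proof (rule maximum_real_frontier[where S = "ball 0 1" and f = D])
    have "(K \<circ> (\<lambda>z. z * cis s)) holomorphic_on ball 0 1" for s
      by (rule holomorphic_on_compose_gen[OF _ hol])
         (auto intro!: holomorphic_intros simp: norm_mult)
    then have "(\<lambda>z. K (z * cis s)) holomorphic_on ball 0 1" for s by (simp add: o_def)
    then show "D holomorphic_on interior (ball 0 1)"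
      unfolding D_def by (auto intro!: holomorphic_intros)
    have "continuous_on (cball 0 1) (\<lambda>z. K (z * cis s))" for s
      by (rule continuous_on_compose2[OF cont]) (auto intro!: continuous_intros simp: norm_mult)
    then show "continuous_on (closure (ball 0 1)) D"
      unfolding D_def by (auto intro!: continuous_intros)
    show "Re (D z) \<le> 1/2" if "z \<in> frontier (ball 0 1)" for z
      using oscillation[of z] that by (simp add: Re_D divide_le_eq)
  qed (use z in auto)
  then show ?thesis by (simp only: D_def mult_deriv_arc_average[OF hol z \<tau>])
qed

lemma circle_potential_arc_average:
  assumes \<tau>: "0 \<le> \<tau>"
    and oscillation: "\<And>z. norm z = 1 \<Longrightarrow> a * (Im (K (z * cis \<tau>)) - Im (K (z * cis (- \<tau>)))) \<le> pi"
  shows "circle_potential (\<lambda>z. of_real a * (arc_average K \<tau> z - of_real (\<tau> / pi)))"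
    (is "circle_potential ?F")
proof -
  have dF: "(?F has_field_derivative of_real a * deriv (arc_average K \<tau>) z) (at z)"
    if "norm z < 1" for z
    using DERIV_arc_average[OF hol that] DERIV_imp_deriv[OF DERIV_arc_average[OF hol that]]
    by (auto intro!: derivative_eq_intros)
  have "z * deriv ?F z = of_real a * (z * deriv (arc_average K \<tau>) z)" if "norm z < 1" for z
    unfolding DERIV_imp_deriv[OF dF[OF that]] by (rule mult.left_commute)
  then have "Re (z * deriv ?F z) \<le> 1/2" if "norm z < 1" for z
    using Re_mult_deriv_arc_average_le[OF \<tau> that oscillation] that by (simp only:)
  moreover have "?F holomorphic_on ball 0 1"
    using dF by (metis holomorphic_on_open mem_ball_0 open_ball)
  moreover have "continuous_on (cball 0 1) ?F"
    by (intro continuous_intros continuous_on_arc_average cont)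
  ultimately show ?thesis using \<tau> by (simp add: circle_potential_def arc_average_0 K0)
qed

context
  assumes nonneg: "\<And>s. Re (K (cis s)) \<ge> 0"
begin

private lemma Re_cis_integrable: "(\<lambda>s. Re (K (cis s))) integrable_on {a..b}"
  using integrable_linear[OF arc_average_integrable[OF cont, of 1] bounded_linear_Re]
  by (simp add: o_def)

lemma Re_arc_average_nonneg: "Re (arc_average K \<tau> (cis t)) \<ge> 0"
  unfolding Re_arc_average_cis[OF cont]
  by (intro divide_nonneg_pos Henstock_Kurzweil_Integration.integral_nonneg
      Re_cis_integrable nonneg) simp

lemma Re_arc_average_ge_1:
  assumes \<phi>: "0 \<le> \<phi>" "\<phi> \<le> pi" and t: "\<bar>t\<bar> \<le> \<tau> - \<phi>"
    and zero: "\<And>s. \<phi> \<le> s \<Longrightarrow> s \<le> 2 * pi - \<phi> \<Longrightarrow> Re (K (cis s)) = 0"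
  shows "Re (arc_average K \<tau> (cis t)) \<ge> 1"
proof -
  let ?k = "\<lambda>s. Re (K (cis s))"
  have "((\<lambda>s. K (of_real 1 * cis s)) has_integral 2 * pi * K 0) {-\<phi>..-\<phi> + 2*pi}"
    by (rule mean_value_cis_from) (simp_all add: cont hol)
  from has_integral_linear[OF this bounded_linear_Re]
  have "(?k has_integral 2 * pi) {-\<phi>..-\<phi> + 2*pi}"
    by (simp add: o_def K0)
  then have "2 * pi = integral {-\<phi>..-\<phi> + 2*pi} ?k" by (simp add: integral_unique)
  also have "\<dots> = integral {-\<phi>..\<phi>} ?k + integral {\<phi>..-\<phi> + 2*pi} ?k"
    using \<phi>
    by (intro Henstock_Kurzweil_Integration.integral_combine[symmetric] Re_cis_integrable) auto
  also have "integral {\<phi>..-\<phi> + 2*pi} ?k = integral {\<phi>..-\<phi> + 2*pi} (\<lambda>_. 0)"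
    by (rule integral_cong) (simp add: zero)
  also have "integral {-\<phi>..\<phi>} ?k \<le> integral {t-\<tau>..t+\<tau>} ?k"
    using t by (intro integral_subset_le Re_cis_integrable) (auto simp: nonneg)
  finally show ?thesis by (simp add: Re_arc_average_cis[OF cont])
qed

end

end

section \<open>Smoothed indicators of arcs\<close>

definition smoothing_kernel :: "real \<Rightarrow> complex \<Rightarrow> complex" where
  "smoothing_kernel \<phi> z = half_disc_map \<phi> z / of_real (tan (\<phi>/4))"

text \<open>The factor \<open>61/50\<close> comes from the bound on the oscillation of \<open>Im\<close> of \<open>half_disc_map\<close>.\<close>

definition smoothing_height :: "real \<Rightarrow> real" where
  "smoothing_height \<phi> = 50/61 * pi * tan (\<phi>/4)"

definition arc_smoothing_potential :: "real \<Rightarrow> real \<Rightarrow> complex \<Rightarrow> complex" where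
  "arc_smoothing_potential \<phi> \<tau> z =
     of_real (smoothing_height \<phi>) * (arc_average (smoothing_kernel \<phi>) \<tau> z - of_real (\<tau> / pi))"

context
  fixes \<phi> \<tau> :: real
  assumes \<phi>: "0 < \<phi>" and \<tau>: "5/2 * \<phi> \<le> \<tau>" "\<tau> < pi"
begin

private lemma \<phi>_less_pi: "\<phi> < pi"
  using \<phi> \<tau> by linarith

private lemma tan_quarter_pos: "tan (\<phi>/4) > 0"
  using \<phi> \<phi>_less_pi by (intro tan_gt_zero) auto

lemma smoothing_height_nonneg: "0 \<le> smoothing_height \<phi>"
  using tan_quarter_pos by (simp add: smoothing_height_def)

lemma smoothing_kernel_0: "smoothing_kernel \<phi> 0 = 1"
  using tan_quarter_pos by (simp add: smoothing_kernel_def half_disc_map_0)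

lemma continuous_on_smoothing_kernel: "continuous_on (cball 0 1) (smoothing_kernel \<phi>)"
  unfolding smoothing_kernel_def[abs_def] using tan_quarter_pos
  by (intro continuous_intros continuous_on_half_disc_map \<phi> \<phi>_less_pi) auto

lemma holomorphic_on_smoothing_kernel: "smoothing_kernel \<phi> holomorphic_on ball 0 1"
  unfolding smoothing_kernel_def[abs_def] using tan_quarter_pos
  by (intro holomorphic_intros holomorphic_on_half_disc_map \<phi> \<phi>_less_pi) auto

lemma Re_smoothing_kernel_cis_nonneg: "Re (smoothing_kernel \<phi> (cis s)) \<ge> 0"
  using Re_half_disc_map_nonneg[OF \<phi> \<phi>_less_pi, of "cis s"] tan_quarter_pos
  by (simp add: smoothing_kernel_def)

lemmas smoothing_kernel =
  continuous_on_smoothing_kernel holomorphic_on_smoothing_kernel smoothing_kernel_0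

lemma circle_potential_arc_smoothing: "circle_potential (arc_smoothing_potential \<phi> \<tau>)"
  unfolding arc_smoothing_potential_def[abs_def]
proof (rule circle_potential_arc_average[OF smoothing_kernel])
  show "0 \<le> \<tau>" using \<phi> \<tau> by linarith
  fix z :: complex assume z: "norm z = 1"
  have "50/61 * pi * (Im (half_disc_map \<phi> (z * cis \<tau>)) - Im (half_disc_map \<phi> (z * cis (- \<tau>)))) \<le>
      50/61 * pi * (61/50)"
    using Im_half_disc_map_diff_le[OF \<phi> \<phi>_less_pi \<tau> z] by (intro mult_left_mono) auto
  then show "smoothing_height \<phi> *
      (Im (smoothing_kernel \<phi> (z * cis \<tau>)) - Im (smoothing_kernel \<phi> (z * cis (- \<tau>)))) \<le> pi"
    using tan_quarter_pos
    by (simp add: smoothing_height_def smoothing_kernel_def flip: diff_divide_distrib)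
qed

lemma Re_arc_smoothing_potential_cis:
  "Re (arc_smoothing_potential \<phi> \<tau> (cis t)) =
     smoothing_height \<phi> * (Re (arc_average (smoothing_kernel \<phi>) \<tau> (cis t)) - \<tau> / pi)"
  by (simp add: arc_smoothing_potential_def)

lemma arc_smoothing_potential_ge:
  assumes "norm z = 1"
  shows "smoothing_height \<phi> * - (\<tau> / pi) \<le> Re (arc_smoothing_potential \<phi> \<tau> z)"
proof -
  have "- (\<tau> / pi) \<le> Re (arc_average (smoothing_kernel \<phi>) \<tau> (cis (Arg z))) - \<tau> / pi"
    using Re_arc_average_nonneg[OF smoothing_kernel Re_smoothing_kernel_cis_nonneg] by simp
  from mult_left_mono[OF this smoothing_height_nonneg]
  have "smoothing_height \<phi> * - (\<tau> / pi) \<le> Re (arc_smoothing_potential \<phi> \<tau> (cis (Arg z)))"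
    by (simp only: Re_arc_smoothing_potential_cis)
  then show ?thesis by (simp only: cis_Arg_unit[OF assms])
qed

lemma arc_smoothing_potential_ge_on_arc:
  assumes "z \<in> arc (\<tau> - \<phi>)"
  shows "smoothing_height \<phi> + smoothing_height \<phi> * - (\<tau> / pi) \<le> Re (arc_smoothing_potential \<phi> \<tau> z)"
proof -
  obtain t where z_eq_cis: "z = cis t" "\<bar>t\<bar> \<le> \<tau> - \<phi>" using assms by (auto simp: arc_def)
  have "Re (smoothing_kernel \<phi> (cis s)) = 0" if "\<phi> \<le> s" "s \<le> 2 * pi - \<phi>" for s
    using Re_half_disc_map_eq_0[OF \<phi> \<phi>_less_pi that] by (simp add: smoothing_kernel_def)
  then have "Re (arc_average (smoothing_kernel \<phi>) \<tau> (cis t)) \<ge> 1"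
    using \<phi> \<phi>_less_pi z_eq_cis(2)
    by (intro Re_arc_average_ge_1[OF smoothing_kernel Re_smoothing_kernel_cis_nonneg, of \<phi>]) auto
  from mult_left_mono[OF this smoothing_height_nonneg] show ?thesis
    by (simp add: z_eq_cis(1) Re_arc_smoothing_potential_cis right_diff_distrib)
qed

end

section \<open>Excess of points on an arc\<close>

lemma (in circle_points) arc_smoothing_bound:
  assumes \<phi>: "0 < \<phi>" "3/2 * \<phi> \<le> pi * l" "pi * l + \<phi> < pi"
  shows "size X * (smoothing_height \<phi> * (arc_mass l - l - \<phi> / pi)) \<le> ln M"
proof -
  define \<tau> where "\<tau> = pi * l + \<phi>"
  have \<tau>: "5/2 * \<phi> \<le> \<tau>" "\<tau> < pi" using \<phi> by (auto simp: \<tau>_def)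
  have "size X * (smoothing_height \<phi> * arc_mass l + smoothing_height \<phi> * - (\<tau> / pi)) \<le> ln M"
  proof (rule arc_potential_mass_bound[OF circle_potential_arc_smoothing[OF \<phi>(1) \<tau>]])
    show "smoothing_height \<phi> * - (\<tau> / pi) \<le> Re (arc_smoothing_potential \<phi> \<tau> z)"
      if "norm z = 1" for z
      by (rule arc_smoothing_potential_ge[OF \<phi>(1) \<tau> that])
    show "smoothing_height \<phi> + smoothing_height \<phi> * - (\<tau> / pi) \<le> Re (arc_smoothing_potential \<phi> \<tau> z)"
      if "z \<in> arc (pi * l)" for z
      using arc_smoothing_potential_ge_on_arc[OF \<phi>(1) \<tau>, of z] that by (simp add: \<tau>_def)
  qed
  moreover have "smoothing_height \<phi> * arc_mass l + smoothing_height \<phi> * - (\<tau> / pi) =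
      smoothing_height \<phi> * (arc_mass l - l - \<phi> / pi)"
    by (simp add: \<tau>_def add_divide_distrib algebra_simps)
  ultimately show ?thesis by simp
qed

lemma ln_cos_ge:
  assumes "0 \<le> l" "l \<le> 3/7"
  shows "- (11/6 * l\<^sup>2) \<le> ln (cos (pi * l / 2))"
proof -
  define y where "y = (pi * l)\<^sup>2 / 8"
  have "(sin (pi * l / 4))\<^sup>2 \<le> (pi * l / 4)\<^sup>2"
    using abs_sin_x_le_abs_x[of "pi * l / 4"] by (simp only: abs_le_square_iff)
  moreover have "cos (pi * l / 2) = 1 - 2 * (sin (pi * l / 4))\<^sup>2"
    using cos_double_sin[of "pi * l / 4"] by simp
  ultimately have cos: "1 - y \<le> cos (pi * l / 2)" by (simp add: y_def power_divide)
  have "pi\<^sup>2 \<le> (63/20)\<^sup>2" using pi_approx by (intro power_mono) auto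
  then have "pi\<^sup>2 * l\<^sup>2 \<le> (63/20)\<^sup>2 * l\<^sup>2" by (intro mult_right_mono) auto
  then have y_le: "y \<le> 3969/3200 * l\<^sup>2" by (simp add: y_def power_mult_distrib power_divide)
  have "l\<^sup>2 \<le> (3/7)\<^sup>2" using assms by (intro power_mono) auto
  then have y_bounds: "0 \<le> y" "y \<le> 23/100" using y_le by (auto simp: y_def power_divide)
  have "- ln (1 - y) = ln (1 / (1 - y))" using y_bounds by (simp add: ln_div)
  also have "\<dots> \<le> 1 / (1 - y) - 1" using y_bounds by (intro ln_le_minus_one) auto
  also have "\<dots> = y / (1 - y)" using y_bounds by (simp add: field_simps)
  also have "\<dots> \<le> y / (77/100)" using y_bounds by (intro divide_left_mono) auto
  also have "\<dots> = 100/77 * y" by simp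
  also have "\<dots> \<le> 11/6 * l\<^sup>2" using y_le zero_le_power2[of l] by linarith
  finally have "- ln (1 - y) \<le> 11/6 * l\<^sup>2" .
  moreover have "ln (1 - y) \<le> ln (cos (pi * l / 2))" using cos y_bounds by (intro ln_mono) auto
  ultimately show ?thesis by simp
qed

lemma tan_ge_self: "0 \<le> x \<Longrightarrow> x < pi/2 \<Longrightarrow> x \<le> tan x" for x :: real
  using abs_tan_ge[of x] tan_gt_zero[of x] by (cases "x = 0") auto

context circle_points
begin

lemma arc_excess_bound_short:
  assumes l: "0 \<le> l" and d: "0 < d" "l \<le> 3/4 * d" and mass: "arc_mass l = l + d"
  shows "size X * (d\<^sup>2 / 2) \<le> ln M"
proof -
  have l_le: "l \<le> 3/7" using arc_mass_le_1[of l] mass d by linarith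
  have "l * (4/3 * l) \<le> l * d" using l d by (intro mult_left_mono) auto
  then have "d\<^sup>2 / 2 \<le> (l + d)\<^sup>2 / 2 - 11/6 * l\<^sup>2"
    by (simp add: power2_eq_square algebra_simps)
  also have "\<dots> \<le> (arc_mass l)\<^sup>2 / 2 + ln (cos (pi * l / 2))"
    using ln_cos_ge[OF l l_le] by (simp add: mass)
  finally have "size X * (d\<^sup>2 / 2) \<le> size X * ((arc_mass l)\<^sup>2 / 2 + ln (cos (pi * l / 2)))"
    by (intro mult_left_mono) auto
  also have "\<dots> \<le> ln M" using arc_mass_bound l l_le by simp
  finally show ?thesis .
qed

lemma arc_excess_bound_long:
  assumes d: "0 < d" "3/4 * d \<le> l" and mass: "arc_mass l = l + d"
  shows "size X * (d\<^sup>2 / 2) \<le> ln M"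
proof -
  define \<phi> where "\<phi> = pi * d / 2"
  have \<phi>: "0 < \<phi>" "3/2 * \<phi> \<le> pi * l" "\<phi> / pi = d / 2"
    using d mult_left_mono[of "3/4 * d" l pi] by (auto simp: \<phi>_def)
  have "l + d / 2 < 1" using arc_mass_le_1[of l] mass d by linarith
  then have "pi * (l + d / 2) < pi * 1" by (intro mult_strict_left_mono) auto
  then have \<phi>_lt: "pi * l + \<phi> < pi" by (simp add: \<phi>_def algebra_simps)
  have "\<phi>/4 \<le> tan (\<phi>/4)" using \<phi>_lt \<phi> by (intro tan_ge_self) auto
  then have "50/61 * pi * (\<phi>/4) \<le> smoothing_height \<phi>"
    unfolding smoothing_height_def by (intro mult_left_mono) auto
  moreover have "50/61 * pi * (\<phi>/4) = 25/244 * pi\<^sup>2 * d" by (simp add: \<phi>_def power2_eq_square)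
  moreover have "(25/8)\<^sup>2 \<le> pi\<^sup>2" using pi_approx by (intro power_mono) auto
  then have "1 * d \<le> 25/244 * pi\<^sup>2 * d" using d by (intro mult_right_mono) (auto simp: power_divide)
  ultimately have "d \<le> smoothing_height \<phi>" by linarith
  then have "d * d / 2 \<le> smoothing_height \<phi> * (d / 2)" using d by simp
  then have "size X * (d\<^sup>2 / 2) \<le> size X * (smoothing_height \<phi> * (d / 2))"
    by (intro mult_left_mono) (simp_all add: power2_eq_square)
  also have "\<dots> = size X * (smoothing_height \<phi> * (arc_mass l - l - \<phi> / pi))" by (simp add: mass \<phi>(3))
  also have "\<dots> \<le> ln M"
    using d \<phi> \<phi>_lt by (intro arc_smoothing_bound) auto
  finally show ?thesis .
qed

lemma arc_excess_bound:
  assumes "0 \<le> l" "l < arc_mass l"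
  shows "size X * ((arc_mass l - l)\<^sup>2 / 2) \<le> ln M"
  using arc_excess_bound_short[of l "arc_mass l - l"]
    arc_excess_bound_long[of "arc_mass l - l" l] assms
  by linarith

end

section \<open>The upper bound\<close>

lemma norm_poly_eq_prod_proots:
  fixes f :: "complex poly"
  shows "norm (poly f w) = norm (lead_coeff f) * (\<Prod>z\<in>#proots f. norm (w - z))"
  by (subst complex_poly_decompose_multiset[of f, symmetric])
     (simp add: norm_mult poly_prod_mset norm_prod_mset)

lemma sqrt_norm_mult_dist_sgn_le:
  fixes w z :: "'a::real_inner"
  assumes "norm w = 1" "z \<noteq> 0"
  shows "sqrt (norm z) * norm (w - sgn z) \<le> norm (w - z)"
proof (rule power2_le_imp_le)
  define r where "r = norm z"
  have r_pos: "r > 0" using assms by (simp add: r_def)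
  have ww: "w \<bullet> w = 1" using assms by (simp add: norm_eq_1)
  define s where "s = sgn z"
  have ss: "s \<bullet> s = 1" using assms by (simp add: s_def norm_sgn flip: norm_eq_1)
  have z_eq: "z = r *\<^sub>R s" using r_pos by (simp add: r_def s_def sgn_div_norm)
  have "(norm (w - z))\<^sup>2 = 1 - 2 * r * (w \<bullet> s) + r\<^sup>2"
    unfolding power2_norm_eq_inner z_eq
    by (simp add: inner_diff inner_commute ww ss power2_eq_square)
  moreover have "(sqrt r * norm (w - s))\<^sup>2 = r * (2 - 2 * (w \<bullet> s))"
    using r_pos by (simp add: power_mult_distrib power2_norm_eq_inner inner_diff inner_commute ww ss)
  moreover have "0 \<le> (1 - r)\<^sup>2" by simp
  ultimately show "(sqrt (norm z) * norm (w - sgn z))\<^sup>2 \<le> (norm (w - z))\<^sup>2"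
    by (simp add: r_def[symmetric] s_def[symmetric] power2_eq_square algebra_simps)
qed simp

definition normalized_max :: "complex poly \<Rightarrow> real" where
  "normalized_max f =
     Sup ((\<lambda>z. norm (poly f z)) ` sphere 0 1) / sqrt (norm (coeff f 0 * lead_coeff f))"

lemma height_eq: "height f = ln (normalized_max f) / real (degree f)"
  by (simp add: height_def normalized_max_def)

lemma root_count_eq_size:
  assumes "f \<noteq> 0"
  shows "root_count f \<alpha> \<beta> = size (filter_mset (\<lambda>z. on_arc \<alpha> \<beta> (angle_frac z)) (proots f))"
  using assms by (auto simp: root_count_def size_multiset_overloaded_eq intro!: sum.cong)

lemma on_arc_imp_mem_arc:
  assumes "z \<noteq> 0" "on_arc \<alpha> \<beta> (angle_frac z)"
  shows "sgn z * cis (- (pi * (\<alpha> + \<beta>))) \<in> arc (pi * (\<beta> - \<alpha>))"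
proof -
  define q where "q = frac (angle_frac z - \<alpha>)"
  define t where "t = pi * (2 * q - (\<beta> - \<alpha>))"
  have q_bounds: "0 \<le> q" "q \<le> \<beta> - \<alpha>" using assms by (auto simp: q_def on_arc_def)
  obtain m :: int where "angle_frac z = \<alpha> + q + of_int m"
    using that[of "\<lfloor>angle_frac z - \<alpha>\<rfloor>"] by (simp add: q_def frac_def)
  moreover have "Arg z = 2 * pi * angle_frac z" by (simp add: angle_frac_def)
  ultimately have Arg: "Arg z - pi * (\<alpha> + \<beta>) = t + 2 * pi * of_int m"
    by (simp add: t_def algebra_simps)
  have "sgn z * cis (- (pi * (\<alpha> + \<beta>))) = cis (Arg z - pi * (\<alpha> + \<beta>))"
    using assms(1) by (simp add: cis_Arg[symmetric] cis_mult)
  also have "\<dots> = cis t * cis (2 * pi * of_int m)" unfolding Arg by (simp only: cis_mult)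
  also have "\<dots> = cis t" by (simp add: cis_multiple_2pi)
  also have "cis t \<in> arc (pi * (\<beta> - \<alpha>))"
  proof -
    have "pi * (2 * q - (\<beta> - \<alpha>)) \<le> pi * (\<beta> - \<alpha>)" "pi * - (\<beta> - \<alpha>) \<le> pi * (2 * q - (\<beta> - \<alpha>))"
      using q_bounds by (intro mult_left_mono; simp)+
    then show ?thesis
      unfolding arc_def by (intro imageI) (simp only: t_def atLeastAtMost_iff mult_minus_right)
  qed
  finally show ?thesis .
qed

context
  fixes f :: "complex poly"
  assumes deg: "degree f \<ge> 1" and f0: "poly f 0 \<noteq> 0"
begin

private lemma nonzero: "f \<noteq> 0"
  using deg by auto

private lemma root_nonzero: "z \<in># proots f \<Longrightarrow> z \<noteq> 0"
  using nonzero f0 by auto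

lemma sqrt_norm_coeff_mult_lead_coeff:
  "sqrt (norm (coeff f 0 * lead_coeff f)) = norm (lead_coeff f) * (\<Prod>z\<in>#proots f. sqrt (norm z))"
proof -
  have "norm (coeff f 0) = norm (lead_coeff f) * (\<Prod>z\<in>#proots f. norm z)"
    using norm_poly_eq_prod_proots[of f 0] by (simp add: poly_0_coeff_0)
  then have "norm (coeff f 0 * lead_coeff f) = (norm (lead_coeff f))\<^sup>2 * (\<Prod>z\<in>#proots f. norm z)"
    by (simp add: norm_mult power2_eq_square)
  then show ?thesis by (simp add: real_sqrt_mult sqrt_prod_mset)
qed

lemma prod_dist_sgn_le_sphere:
  assumes w: "norm w = 1"
  shows "(\<Prod>z\<in>#proots f. norm (w - sgn z)) \<le> normalized_max f"
proof -
  let ?s = "sqrt (norm (coeff f 0 * lead_coeff f))"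
  have "(\<Prod>z\<in>#proots f. norm (w - sgn z)) * ?s =
      norm (lead_coeff f) * (\<Prod>z\<in>#proots f. sqrt (norm z) * norm (w - sgn z))"
    by (simp add: sqrt_norm_coeff_mult_lead_coeff prod_mset.distrib)
  also have "\<dots> \<le> norm (lead_coeff f) * (\<Prod>z\<in>#proots f. norm (w - z))"
    using w root_nonzero
    by (intro mult_left_mono prod_mset_mono_nonneg sqrt_norm_mult_dist_sgn_le) auto
  also have "\<dots> = norm (poly f w)" by (simp add: norm_poly_eq_prod_proots)
  also have "\<dots> \<le> Sup ((\<lambda>z. norm (poly f z)) ` sphere 0 1)"
  proof (rule cSUP_upper)
    show "bdd_above ((\<lambda>z. norm (poly f z)) ` sphere 0 1)"
      by (intro bounded_imp_bdd_above compact_imp_bounded compact_continuous_image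
          continuous_intros) auto
  qed (use w in auto)
  finally show ?thesis
    using nonzero f0 by (simp add: normalized_max_def pos_le_divide_eq poly_0_coeff_0)
qed

lemma prod_dist_sgn_le:
  assumes w: "norm w < 1"
  shows "(\<Prod>z\<in>#proots f. norm (w - sgn z)) \<le> normalized_max f"
proof -
  define g where "g = (\<Prod>z\<in>#proots f. [:- sgn z, 1:])"
  have norm_g: "norm (poly g w) = (\<Prod>z\<in>#proots f. norm (w - sgn z))" for w
    by (simp add: g_def poly_prod_mset norm_prod_mset)
  have "norm (poly g w) \<le> normalized_max f"
  proof (rule maximum_modulus_frontier[where S = "ball 0 1" and f = "poly g"])
    show "poly g holomorphic_on interior (ball 0 1)"
      by (auto simp: holomorphic_on_open intro!: exI poly_DERIV)
    show "continuous_on (closure (ball 0 1)) (poly g)"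
      by (intro continuous_at_imp_continuous_on ballI poly_isCont)
    show "norm (poly g z) \<le> normalized_max f" if "z \<in> frontier (ball 0 1)" for z
      unfolding norm_g using that by (intro prod_dist_sgn_le_sphere) simp
  qed (use w in auto)
  then show ?thesis by (simp add: norm_g)
qed

lemma circle_points_roots:
  "circle_points (image_mset (\<lambda>z. sgn z * cis a) (proots f)) (normalized_max f)"
proof
  fix w :: complex assume w: "norm w < 1"
  have "norm (w - sgn z * cis a) = norm (w * cis (- a) - sgn z)" for z
  proof -
    have "w * cis (- a) - sgn z = (w - sgn z * cis a) * cis (- a)"
      by (simp add: left_diff_distrib mult.assoc cis_mult)
    then show ?thesis by (simp add: norm_mult)
  qed
  then show "(\<Prod>x\<in>#image_mset (\<lambda>z. sgn z * cis a) (proots f). norm (w - x)) \<le> normalized_max f"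
    using prod_dist_sgn_le[of "w * cis (- a)"] w
    by (simp add: norm_mult image_mset.compositionality o_def)
qed (use root_nonzero in \<open>auto simp: norm_mult norm_sgn\<close>)

lemma normalized_max_ge_1: "normalized_max f \<ge> 1"
  by (rule circle_points.prod_dist_bound_ge_1[OF circle_points_roots])

lemma height_nonneg: "height f \<ge> 0"
  using normalized_max_ge_1 by (simp add: height_eq)

lemma root_count_excess_le:
  assumes "\<alpha> \<le> \<beta>" "\<beta> < \<alpha> + 1"
  shows "real (root_count f \<alpha> \<beta>) / real (degree f) - (\<beta> - \<alpha>) \<le> sqrt 2 * sqrt (height f)"
proof -
  define l where "l = \<beta> - \<alpha>"
  define X where "X = image_mset (\<lambda>z. sgn z * cis (- (pi * (\<alpha> + \<beta>)))) (proots f)"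
  interpret circle_points X "normalized_max f"
    unfolding X_def by (rule circle_points_roots)
  have size: "size X = degree f" by (simp add: X_def size_proots_complex)
  have "root_count f \<alpha> \<beta> \<le> size (filter_mset (\<lambda>x. x \<in> arc (pi * l)) X)"
    unfolding X_def l_def filter_mset_image_mset root_count_eq_size[OF nonzero] size_image_mset
    by (intro size_mset_mono filter_mset_mono_strong subset_mset.order_refl
        on_arc_imp_mem_arc root_nonzero)
  then have "real (root_count f \<alpha> \<beta>) / real (degree f) \<le> arc_mass l"
    by (simp add: arc_mass_def size divide_right_mono)
  moreover have "arc_mass l - l \<le> sqrt 2 * sqrt (height f)"
  proof (cases "l < arc_mass l")
    case False
    then have "arc_mass l - l \<le> 0" by simp
    also have "0 \<le> sqrt 2 * sqrt (height f)" using height_nonneg by simp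
    finally show ?thesis .
  next
    case True
    then have "degree f * ((arc_mass l - l)\<^sup>2 / 2) \<le> ln (normalized_max f)"
      using arc_excess_bound[of l] assms by (simp add: size l_def)
    then have "(arc_mass l - l)\<^sup>2 / 2 \<le> height f"
      using deg by (simp add: height_eq le_divide_eq mult.commute)
    then have "(arc_mass l - l)\<^sup>2 \<le> 2 * height f" by simp
    then have "arc_mass l - l \<le> sqrt (2 * height f)" by (rule real_le_rsqrt)
    then show ?thesis by (simp only: real_sqrt_mult)
  qed
  ultimately show ?thesis by (simp add: l_def)
qed

lemma discrepancy_le_sqrt_height: "discrepancy f \<le> sqrt 2 * sqrt (height f)"
  unfolding discrepancy_def
proof (rule cSup_least)
  show "{real (root_count f \<alpha> \<beta>) / real (degree f) - (\<beta> - \<alpha>) |\<alpha> \<beta>. \<alpha> \<le> \<beta> \<and> \<beta> < \<alpha> + 1} \<noteq> {}"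
    by (auto intro!: exI[of _ "0::real"])
qed (use root_count_excess_le in blast)

lemma discrepancy_ge:
  assumes "\<alpha> \<le> \<beta>" "\<beta> < \<alpha> + 1"
  shows "real (root_count f \<alpha> \<beta>) / real (degree f) - (\<beta> - \<alpha>) \<le> discrepancy f"
  unfolding discrepancy_def
proof (rule cSup_upper)
  show "bdd_above {real (root_count f \<alpha> \<beta>) / real (degree f) - (\<beta> - \<alpha>) |\<alpha> \<beta>. \<alpha> \<le> \<beta> \<and> \<beta> < \<alpha> + 1}"
    using root_count_excess_le by (intro bdd_aboveI[of _ "sqrt 2 * sqrt (height f)"]) blast
qed (use assms in blast)

end

section \<open>Oscillations with increasing frequency\<close>

lemma second_derivative_at_local_max:
  fixes f f' :: "real \<Rightarrow> real"
  assumes e: "0 < e"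
    and df: "\<And>x. \<bar>x - a\<bar> < e \<Longrightarrow> (f has_real_derivative f' x) (at x)"
    and df': "(f' has_real_derivative f'') (at a)"
    and max: "\<And>x. \<bar>x - a\<bar> < e \<Longrightarrow> f x \<le> f a"
  shows "f' a = 0" and "f'' \<le> 0"
proof -
  show zero: "f' a = 0"
    using e df[of a] max by (intro DERIV_local_max[of f "f' a" a e]) (auto simp: abs_minus_commute)
  show "f'' \<le> 0"
  proof (rule ccontr)
    assume "\<not> f'' \<le> 0"
    then have "\<exists>d>0. \<forall>h>0. h < d \<longrightarrow> f' a < f' (a + h)"
      using df' by (intro DERIV_pos_inc_right) auto
    then obtain d where d: "d > 0" "\<And>h. 0 < h \<Longrightarrow> h < d \<Longrightarrow> 0 < f' (a + h)"
      unfolding zero by blast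
    define x where "x = a + min d e / 2"
    have x_between: "a < x" "x < a + d" "x < a + e" using d(1) e by (auto simp: x_def)
    then obtain \<xi> where \<xi>: "a < \<xi>" "\<xi> < x" "f x - f a = (x - a) * f' \<xi>"
      using MVT2[OF x_between(1), of f f'] df by auto
    have "f' \<xi> > 0" using d(2)[of "\<xi> - a"] \<xi> x_between by simp
    then have "(x - a) * f' \<xi> > 0" using x_between(1) by simp
    then show False using max[of x] \<xi>(3) x_between by simp
  qed
qed

locale increasing_oscillation =
  fixes y y' Q Q' :: "real \<Rightarrow> real" and b :: real
  assumes continuous: "continuous_on {0..b} y"
    and DERIV_y: "0 < t \<Longrightarrow> t \<le> b \<Longrightarrow> (y has_real_derivative y' t) (at t)"
    and DERIV_y': "0 < t \<Longrightarrow> t \<le> b \<Longrightarrow> (y' has_real_derivative - (Q t * y t)) (at t)"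
    and DERIV_Q: "0 < t \<Longrightarrow> t \<le> b \<Longrightarrow> (Q has_real_derivative Q' t) (at t)"
    and Q'_nonneg: "0 < t \<Longrightarrow> t \<le> b \<Longrightarrow> Q' t \<ge> 0"
    and y_0: "y 0 = 0" and y'_b: "y' b = 0" and b_pos: "0 < b"
begin

lemma Q_mono:
  assumes "0 < s" "s \<le> t" "t \<le> b"
  shows "Q s \<le> Q t"
proof (rule DERIV_nonneg_imp_nondecreasing[OF assms(2)])
  fix x assume "s \<le> x" "x \<le> t"
  with assms have "0 < x" "x \<le> b" by auto
  then show "\<exists>d. (Q has_real_derivative d) (at x) \<and> 0 \<le> d" using DERIV_Q Q'_nonneg by blast
qed

definition energy :: "real \<Rightarrow> real" where
  "energy t = Q t * (y t)\<^sup>2 + (y' t)\<^sup>2"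

lemma energy_le:
  assumes "0 < a" "a \<le> b"
  shows "energy a \<le> Q b * (y b)\<^sup>2"
proof -
  have "energy a \<le> energy b"
  proof (rule DERIV_nonneg_imp_nondecreasing[OF assms(2)])
    fix t assume t: "a \<le> t" "t \<le> b"
    then have "0 < t" using assms by simp
    have "(energy has_real_derivative Q' t * (y t)\<^sup>2) (at t)"
      unfolding energy_def[abs_def]
      by (auto intro!: derivative_eq_intros DERIV_Q DERIV_y DERIV_y' \<open>0 < t\<close> t
          simp: power2_eq_square algebra_simps)
    then show "\<exists>d. (energy has_real_derivative d) (at t) \<and> 0 \<le> d"
      using Q'_nonneg[OF \<open>0 < t\<close> t(2)] by (intro exI[of _ "Q' t * (y t)\<^sup>2"]) simp
  qed
  then show ?thesis by (simp add: energy_def[of b] y'_b)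
qed

lemma Q_nonneg_at_interior_max:
  assumes a: "0 < a" "a < b" "y a \<noteq> 0" and max: "\<And>t. 0 \<le> t \<Longrightarrow> t \<le> b \<Longrightarrow> \<bar>y t\<bar> \<le> \<bar>y a\<bar>"
  shows "Q a \<ge> 0"
proof -
  have dy2: "((\<lambda>t. (y t)\<^sup>2) has_real_derivative 2 * (y t * y' t)) (at t)"
    if "\<bar>t - a\<bar> < min a (b - a)" for t
    using that by (auto intro!: derivative_eq_intros DERIV_y)
  have "((\<lambda>t. 2 * (y t * y' t)) has_real_derivative 2 * ((y' a)\<^sup>2 - Q a * (y a)\<^sup>2)) (at a)"
    using a
    by (auto intro!: derivative_eq_intros DERIV_y DERIV_y' simp: power2_eq_square algebra_simps)
  moreover have "(y t)\<^sup>2 \<le> (y a)\<^sup>2" if "\<bar>t - a\<bar> < min a (b - a)" for t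
    using max[of t] that by (auto simp: abs_le_square_iff)
  moreover have "0 < min a (b - a)" using a by simp
  ultimately have "2 * (y a * y' a) = 0" "2 * ((y' a)\<^sup>2 - Q a * (y a)\<^sup>2) \<le> 0"
    using second_derivative_at_local_max[OF _ dy2] by blast+
  then have "0 \<le> Q a * (y a)\<^sup>2" using a(3) by simp
  then show ?thesis using a(3) by (simp add: zero_le_mult_iff)
qed

lemma abs_le_if_Q_nonneg:
  assumes a: "0 < a" "a < b" "Q a \<ge> 0" and Q_b_le: "Q b \<le> n\<^sup>2" "n \<ge> 0"
  shows "\<bar>y a\<bar> \<le> (1 + b * n) * \<bar>y b\<bar>"
proof -
  obtain \<xi> where \<xi>: "a < \<xi>" "\<xi> < b" "y b - y a = (b - a) * y' \<xi>"
    using MVT2[OF a(2) DERIV_y] a(1) by auto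
  have "(y' \<xi>)\<^sup>2 \<le> energy \<xi>"
    using Q_mono[of a \<xi>] a \<xi> by (simp add: energy_def)
  also have "\<dots> \<le> Q b * (y b)\<^sup>2" using \<xi> a by (intro energy_le) auto
  also have "\<dots> \<le> n\<^sup>2 * (y b)\<^sup>2" by (intro mult_right_mono Q_b_le) auto
  also have "\<dots> = (n * \<bar>y b\<bar>)\<^sup>2" by (simp add: power_mult_distrib)
  finally have "\<bar>y' \<xi>\<bar> \<le> n * \<bar>y b\<bar>"
    using Q_b_le(2) by (simp add: abs_le_square_iff[symmetric] abs_mult)
  have "\<bar>y a\<bar> \<le> \<bar>y b\<bar> + \<bar>(b - a) * y' \<xi>\<bar>" using \<xi>(3) by linarith
  also have "\<bar>(b - a) * y' \<xi>\<bar> \<le> b * (n * \<bar>y b\<bar>)"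
    using a \<open>\<bar>y' \<xi>\<bar> \<le> n * \<bar>y b\<bar>\<close> by (auto simp: abs_mult intro!: mult_mono)
  finally show ?thesis by (simp add: algebra_simps)
qed

text \<open>At an interior maximum of \<open>|y|\<close> the potential \<open>Q\<close> is nonnegative, so there the energy controls
  \<open>y'\<close> on the way to \<open>b\<close>.\<close>

lemma abs_solution_le:
  assumes Q_b_le: "Q b \<le> n\<^sup>2" "n \<ge> 0" and t: "0 \<le> t" "t \<le> b"
  shows "\<bar>y t\<bar> \<le> (1 + b * n) * \<bar>y b\<bar>"
proof -
  have "\<exists>a\<in>{0..b}. \<forall>t\<in>{0..b}. \<bar>y t\<bar> \<le> \<bar>y a\<bar>"
    using b_pos by (intro continuous_attains_sup continuous_on_rabs continuous) auto
  then obtain a where a: "a \<in> {0..b}" and max: "\<And>t. t \<in> {0..b} \<Longrightarrow> \<bar>y t\<bar> \<le> \<bar>y a\<bar>"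
    by blast
  consider (zero) "y a = 0" | (endpoint) "a = b" | (interior) "0 < a" "a < b" "y a \<noteq> 0"
    using a y_0 by force
  then have "\<bar>y a\<bar> \<le> (1 + b * n) * \<bar>y b\<bar>"
  proof cases
    case zero
    then show ?thesis using Q_b_le b_pos by simp
  next
    case endpoint
    then show ?thesis using Q_b_le b_pos by (simp add: distrib_right)
  next
    case interior
    then show ?thesis using max Q_b_le by (intro abs_le_if_Q_nonneg Q_nonneg_at_interior_max) auto
  qed
  then show ?thesis using max[of t] t by simp
qed

end

section \<open>Gegenbauer polynomials\<close>

definition multichoose :: "real \<Rightarrow> nat \<Rightarrow> real" where
  "multichoose a k = pochhammer a k / fact k"

lemma multichoose_0 [simp]: "multichoose a 0 = 1"
  by (simp add: multichoose_def)

lemma multichoose_pos: "a > 0 \<Longrightarrow> multichoose a k > 0"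
  by (simp add: multichoose_def pochhammer_pos)

lemma multichoose_Suc: "real (Suc k) * multichoose a (Suc k) = (a + real k) * multichoose a k"
  by (simp add: multichoose_def pochhammer_Suc divide_simps)

lemma multichoose_plus_1: "a * multichoose (a + 1) k = (a + real k) * multichoose a k"
  using pochhammer_Suc[of a k] pochhammer_rec[of a k] by (simp add: multichoose_def mult.commute)

lemma gbinomial_minus_eq_multichoose: "(- a) gchoose k = (-1) ^ k * multichoose a k"
  by (simp add: gbinomial_pochhammer multichoose_def)

lemma fps_multichoose:
  "inverse ((1 + fps_X) ^ m) = Abs_fps (\<lambda>k. (-1) ^ k * multichoose (real m) k)"
  "inverse ((1 - fps_X) ^ m) = Abs_fps (multichoose (real m))"
proof -
  show plus: "inverse ((1 + fps_X) ^ m) = Abs_fps (\<lambda>k. (-1) ^ k * multichoose (real m) k)"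
    by (simp add: fps_eq_iff gbinomial_minus_eq_multichoose flip: fps_binomial_minus_of_nat)
  have "inverse ((1 - fps_X) ^ m) = inverse ((1 + fps_X) ^ m) oo (- fps_X :: real fps)"
    by (subst fps_inverse_compose)
       (simp_all add: fps_power_zeroth_eq_one fps_compose_power[symmetric] fps_compose_add_distrib)
  then show "inverse ((1 - fps_X) ^ m) = Abs_fps (multichoose (real m))"
    unfolding plus fps_compose_uminus' by (simp add: fps_eq_iff minus_one_power_iff)
qed

lemma multichoose_alternating_sum:
  "(\<Sum>k\<le>2 * M. (-1) ^ k * (multichoose (real m) k * multichoose (real m) (2 * M - k))) =
    multichoose (real m) M"
proof -
  let ?X = "fps_X :: real fps" and ?A = "Abs_fps (multichoose (real m))"
  let ?B = "Abs_fps (\<lambda>k. (-1) ^ k * multichoose (real m) k)"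
  have "?A oo ?X\<^sup>2 = inverse ((1 - ?X) ^ m oo ?X\<^sup>2)"
    unfolding fps_multichoose(2)[symmetric]
    by (rule fps_inverse_compose) (auto simp: fps_power_zeroth_eq_one)
  also have "(1 - ?X) ^ m oo ?X\<^sup>2 = (1 - ?X\<^sup>2) ^ m"
    by (simp add: fps_compose_power[symmetric] fps_compose_sub_distrib)
  also have "1 - ?X\<^sup>2 = (1 + ?X) * (1 - ?X)" by (simp add: algebra_simps power2_eq_square)
  also have "inverse (((1 + ?X) * (1 - ?X)) ^ m) = ?B * ?A"
    by (simp add: power_mult_distrib fps_inverse_mult fps_multichoose)
  finally have "fps_nth (?B * ?A) (2 * M) = fps_nth (?A oo ?X\<^sup>2) (2 * M)" by simp
  also have "\<dots> = (\<Sum>i = 0..2 * M. if i = M then multichoose (real m) i else 0)"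
    unfolding fps_compose_nth by (intro sum.cong) (auto simp flip: power_mult)
  also have "\<dots> = multichoose (real m) M" by simp
  finally show ?thesis by (simp only: fps_mult_nth fps_nth_Abs_fps atMost_atLeast0 mult.assoc)
qed

lemma multichoose_ratio_le:
  assumes "m > 0" "M > 0"
  shows "2 ^ m * multichoose (real m) M / multichoose (real m) (2 * M) \<le>
    2 * exp (real m * (real m - 1) / (4 * real M))"
  using assms(1)
proof (induction m rule: nat_induct_non_zero)
  case 1
  have "multichoose 1 k = 1" for k by (simp add: multichoose_def flip: pochhammer_fact)
  then show ?case by simp
next
  case (Suc m)
  let ?r = "\<lambda>m. 2 ^ m * multichoose (real m) M / multichoose (real m) (2 * M)"
  have rec: "multichoose (real (Suc m)) k = multichoose (real m) k * (real m + real k) / real m"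
    for k
    using multichoose_plus_1[of "real m" k] Suc(1) by (simp add: field_simps)
  have "2 * x * (g * p / k) / (h * q / k) = x * g / h * (2 * p / q)"
    if "k > 0" for x g h k p q :: real
    using that by simp
  then have "?r (Suc m) = ?r m * (2 * (real m + real M) / (real m + real (2 * M)))"
    unfolding rec power_Suc using Suc(1) by simp
  also have "\<dots> \<le> 2 * exp (real m * (real m - 1) / (4 * real M)) * exp (real m / (2 * real M))"
  proof (rule mult_mono[OF Suc.IH])
    have "2 * (real m + real M) / (real m + real (2 * M)) = 1 + real m / (real m + real (2 * M))"
      using Suc(1) by (simp add: field_simps)
    also have "\<dots> \<le> 1 + real m / (2 * real M)"
      using assms by (intro add_left_mono divide_left_mono) auto
    also have "\<dots> \<le> exp (real m / (2 * real M))" by (rule exp_ge_add_one_self)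
    finally show "2 * (real m + real M) / (real m + real (2 * M)) \<le> exp (real m / (2 * real M))" .
  qed auto
  also have "\<dots> = 2 * exp (real (Suc m) * (real (Suc m) - 1) / (4 * real M))"
    using assms by (simp add: field_simps flip: exp_add)
  finally show ?case .
qed

definition gegenbauer_coeff :: "real \<Rightarrow> nat \<Rightarrow> nat \<Rightarrow> real" where
  "gegenbauer_coeff a N k = multichoose a k * multichoose a (N - k)"

lemma gegenbauer_coeff_reflect: "k \<le> N \<Longrightarrow> gegenbauer_coeff a N (N - k) = gegenbauer_coeff a N k"
  by (simp add: gegenbauer_coeff_def)

lemma gegenbauer_coeff_Suc:
  assumes "k < N"
  shows "real (Suc k) * (real N - real (Suc k) + a) * gegenbauer_coeff a N (Suc k) =
    (real N - real k) * (real k + a) * gegenbauer_coeff a N k"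
proof -
  define q where "q = N - Suc k"
  have diffs: "N - k = Suc q" "N - Suc k = q"
    "real N - real k = real (Suc q)" "real N - real (Suc k) = real q"
    using assms by (auto simp: q_def of_nat_diff)
  have "real (Suc k) * (real q + a) * (multichoose a (Suc k) * multichoose a q) =
      (real (Suc k) * multichoose a (Suc k)) * ((a + real q) * multichoose a q)"
    by (simp add: mult_ac add.commute)
  also have "\<dots> = ((a + real k) * multichoose a k) * (real (Suc q) * multichoose a (Suc q))"
    by (simp only: multichoose_Suc)
  finally show ?thesis unfolding gegenbauer_coeff_def diffs by (simp only: mult_ac add.commute)
qed

definition gegenbauer_freq :: "nat \<Rightarrow> nat \<Rightarrow> real" where
  "gegenbauer_freq N k = real N - 2 * real k"

text \<open>The Gegenbauer polynomial \<open>C\<^sub>N\<^sup>a\<close> at \<open>cos t\<close>.\<close>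

definition gegenbauer :: "real \<Rightarrow> nat \<Rightarrow> real \<Rightarrow> real" where
  "gegenbauer a N t = (\<Sum>k\<le>N. gegenbauer_coeff a N k * cos (gegenbauer_freq N k * t))"

definition gegenbauer' :: "real \<Rightarrow> nat \<Rightarrow> real \<Rightarrow> real" where
  "gegenbauer' a N t =
     (\<Sum>k\<le>N. gegenbauer_coeff a N k * (- gegenbauer_freq N k * sin (gegenbauer_freq N k * t)))"

definition gegenbauer'' :: "real \<Rightarrow> nat \<Rightarrow> real \<Rightarrow> real" where
  "gegenbauer'' a N t =
     (\<Sum>k\<le>N. gegenbauer_coeff a N k * (- (gegenbauer_freq N k)\<^sup>2 * cos (gegenbauer_freq N k * t)))"

lemma DERIV_gegenbauer: "(gegenbauer a N has_real_derivative gegenbauer' a N t) (at t)"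
  unfolding gegenbauer_def[abs_def] gegenbauer'_def
  by (auto intro!: derivative_eq_intros sum.cong simp: algebra_simps)

lemma DERIV_gegenbauer': "(gegenbauer' a N has_real_derivative gegenbauer'' a N t) (at t)"
  unfolding gegenbauer'_def[abs_def] gegenbauer''_def
  by (auto intro!: derivative_eq_intros sum.cong simp: algebra_simps power2_eq_square)

lemma gegenbauer_ode:
  "sin t * gegenbauer'' a N t + 2 * a * cos t * gegenbauer' a N t +
     real N * (real N + 2 * a) * sin t * gegenbauer a N t = 0"
proof -
  let ?c = "gegenbauer_coeff a N" and ?j = "gegenbauer_freq N"
  define T where "T k = 2 * (real k * (real N - real k + a) * ?c k) * sin ((?j k + 1) * t)" for k
  define S where "S k = 2 * ((real N - real k) * (real k + a) * ?c k) * sin ((?j k - 1) * t)" for k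
  have summand: "?c k * (sin t * (- (?j k)\<^sup>2 * cos (?j k * t)) +
      2 * a * cos t * (- ?j k * sin (?j k * t))
      + real N * (real N + 2 * a) * sin t * cos (?j k * t)) = T k - S k" for k
  proof -
    define j where "j = ?j k"
    have N_eq: "real N = j + 2 * real k" by (simp add: j_def gegenbauer_freq_def)
    show ?thesis
      unfolding T_def S_def j_def[symmetric] distrib_right left_diff_distrib
        sin_add sin_diff mult_1 N_eq
      by (simp add: algebra_simps power2_eq_square)
  qed
  have "sin t * gegenbauer'' a N t + 2 * a * cos t * gegenbauer' a N t +
     real N * (real N + 2 * a) * sin t * gegenbauer a N t =
     (\<Sum>k\<le>N. ?c k * (sin t * (- (?j k)\<^sup>2 * cos (?j k * t)) + 2 * a * cos t * (- ?j k * sin (?j k * t))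
      + real N * (real N + 2 * a) * sin t * cos (?j k * t)))"
    unfolding gegenbauer_def gegenbauer'_def gegenbauer''_def
      sum_distrib_left sum.distrib[symmetric]
    by (intro sum.cong refl) (simp add: algebra_simps)
  also have "\<dots> = (\<Sum>k\<le>N. T k) - (\<Sum>k\<le>N. S k)"
    by (simp only: summand sum_subtractf)
  also have "T (Suc k) = S k" if "k < N" for k
  proof -
    have freq: "?j (Suc k) + 1 = ?j k - 1" by (simp add: gegenbauer_freq_def)
    show ?thesis unfolding T_def S_def gegenbauer_coeff_Suc[OF that] freq ..
  qed
  then have "(\<Sum>k\<le>N. T k) = T 0 + (\<Sum>k<N. S k)" by (simp add: sum.atMost_shift)
  also have "\<dots> = (\<Sum>k\<le>N. S k)" by (simp add: T_def S_def flip: lessThan_Suc_atMost)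
  finally show ?thesis by simp
qed

section \<open>Weighted Gegenbauer polynomials\<close>

definition weighted_gegenbauer :: "nat \<Rightarrow> nat \<Rightarrow> real \<Rightarrow> real" where
  "weighted_gegenbauer m N t = sin t ^ m * gegenbauer (real m) N t"

definition weighted_gegenbauer' :: "nat \<Rightarrow> nat \<Rightarrow> real \<Rightarrow> real" where
  "weighted_gegenbauer' m N t =
     sin t ^ m * (real m * cot t * gegenbauer (real m) N t + gegenbauer' (real m) N t)"

definition gegenbauer_potential :: "nat \<Rightarrow> nat \<Rightarrow> real \<Rightarrow> real" where
  "gegenbauer_potential m N t = (real N + real m)\<^sup>2 - real m * (real m - 1) / (sin t)\<^sup>2"

lemma DERIV_sin_power:
  assumes "sin t \<noteq> 0"
  shows "((\<lambda>t. sin t ^ m) has_real_derivative real m * cot t * sin t ^ m) (at t)"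
proof -
  have "real m * (cos t * sin t ^ (m - Suc 0)) = real m * cot t * sin t ^ m"
    using assms by (cases m) (auto simp: cot_def)
  then show ?thesis using DERIV_power[OF DERIV_sin[of t], of m] by (simp only: of_nat_mult)
qed

lemma DERIV_weighted_gegenbauer:
  assumes "sin t \<noteq> 0"
  shows "(weighted_gegenbauer m N has_real_derivative weighted_gegenbauer' m N t) (at t)"
  using DERIV_mult[OF DERIV_sin_power[OF assms, of m] DERIV_gegenbauer[of "real m" N t]]
  by (simp add: weighted_gegenbauer_def[abs_def] weighted_gegenbauer'_def algebra_simps)

lemma DERIV_weighted_gegenbauer':
  assumes "sin t \<noteq> 0"
  shows "(weighted_gegenbauer' m N has_real_derivative
    - (gegenbauer_potential m N t * weighted_gegenbauer m N t)) (at t)"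
proof -
  define G G' G'' where "G = gegenbauer (real m) N t" and "G' = gegenbauer' (real m) N t"
    and "G'' = gegenbauer'' (real m) N t"
  have "((\<lambda>t. real m * cot t * gegenbauer (real m) N t + gegenbauer' (real m) N t) has_real_derivative
      real m * cot t * G' - real m * inverse ((sin t)\<^sup>2) * G + G'') (at t)"
    unfolding G_def G'_def G''_def using assms
    by (auto intro!: derivative_eq_intros DERIV_cot DERIV_gegenbauer DERIV_gegenbauer')
  from DERIV_mult[OF DERIV_sin_power[OF assms, of m] this]
  have "(weighted_gegenbauer' m N has_real_derivative
      sin t ^ m * (real m * cot t * (real m * cot t * G + G') +
        (real m * cot t * G' - real m * inverse ((sin t)\<^sup>2) * G + G''))) (at t)"
    by (simp add: weighted_gegenbauer'_def[abs_def] G_def G'_def algebra_simps)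
  also have "real m * cot t * (real m * cot t * G + G') +
        (real m * cot t * G' - real m * inverse ((sin t)\<^sup>2) * G + G'') =
      (real m)\<^sup>2 * (cot t)\<^sup>2 * G - real m * inverse ((sin t)\<^sup>2) * G + (G'' + 2 * real m * cot t * G')"
    by (simp add: algebra_simps power2_eq_square)
  also have "G'' + 2 * real m * cot t * G' = - (real N * (real N + 2 * real m) * G)"
    using gegenbauer_ode[of t "real m" N] assms
    by (simp add: G_def G'_def G''_def cot_def field_simps)
  also have "(cot t)\<^sup>2 = inverse ((sin t)\<^sup>2) - 1"
    using assms
    by (simp add: cot_def power_divide cos_squared_eq diff_divide_distrib inverse_eq_divide)
  also have "sin t ^ m * ((real m)\<^sup>2 * (inverse ((sin t)\<^sup>2) - 1) * G -
        real m * inverse ((sin t)\<^sup>2) * G + - (real N * (real N + 2 * real m) * G)) =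
      - (gegenbauer_potential m N t * weighted_gegenbauer m N t)"
    by (simp add: gegenbauer_potential_def weighted_gegenbauer_def G_def divide_inverse
        algebra_simps power2_eq_square)
  finally show ?thesis .
qed

lemma DERIV_gegenbauer_potential:
  assumes "sin t \<noteq> 0"
  shows "(gegenbauer_potential m N has_real_derivative
    2 * (real m * (real m - 1)) * cos t / sin t ^ 3) (at t)"
  unfolding gegenbauer_potential_def[abs_def] using assms
  by (auto intro!: derivative_eq_intros simp: field_simps power2_eq_square power3_eq_cube)

lemma gegenbauer'_half_pi:
  assumes "even N"
  shows "gegenbauer' a N (pi/2) = 0"
proof -
  obtain M where N_eq: "N = 2 * M" using assms by auto
  have "sin (gegenbauer_freq N k * (pi/2)) = 0" for k
  proof -
    have "gegenbauer_freq N k * (pi/2) = of_int (int M - int k) * pi"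
      by (simp add: N_eq gegenbauer_freq_def algebra_simps)
    then show ?thesis by (metis sin_npi_int mult.commute)
  qed
  then show ?thesis by (simp add: gegenbauer'_def)
qed

lemma abs_gegenbauer_half_pi:
  "\<bar>gegenbauer (real m) (2 * M) (pi/2)\<bar> = multichoose (real m) M"
proof -
  have "cos (gegenbauer_freq (2 * M) k * (pi/2)) = (-1) ^ M * (-1) ^ k" for k
  proof -
    have angle: "gegenbauer_freq (2 * M) k * (pi/2) = pi * real M - pi * real k"
      by (simp add: gegenbauer_freq_def algebra_simps)
    show ?thesis unfolding angle by (simp add: cos_diff cos_npi2 sin_npi2)
  qed
  then have "gegenbauer (real m) (2 * M) (pi/2) =
      (-1) ^ M * (\<Sum>k\<le>2 * M. (-1) ^ k * (multichoose (real m) k * multichoose (real m) (2 * M - k)))"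
    unfolding gegenbauer_def gegenbauer_coeff_def sum_distrib_left by (simp add: mult_ac)
  also have "\<dots> = (-1) ^ M * multichoose (real m) M" by (simp only: multichoose_alternating_sum)
  finally show ?thesis
    by (simp add: abs_mult multichoose_def pochhammer_of_nat)
qed

lemma increasing_oscillation_weighted_gegenbauer:
  assumes "m > 0" "even N"
  shows "increasing_oscillation (weighted_gegenbauer m N) (weighted_gegenbauer' m N)
    (gegenbauer_potential m N) (\<lambda>t. 2 * (real m * (real m - 1)) * cos t / sin t ^ 3) (pi/2)"
proof
  have pos: "sin t > 0" if "0 < t" "t \<le> pi/2" for t using that by (intro sin_gt_zero) auto
  show "continuous_on {0..pi/2} (weighted_gegenbauer m N)"
    unfolding weighted_gegenbauer_def[abs_def] gegenbauer_def by (intro continuous_intros)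
  fix t :: real assume t: "0 < t" "t \<le> pi/2"
  then have "sin t \<noteq> 0" using pos by force
  then show "(weighted_gegenbauer m N has_real_derivative weighted_gegenbauer' m N t) (at t)"
    "(weighted_gegenbauer' m N has_real_derivative
      - (gegenbauer_potential m N t * weighted_gegenbauer m N t)) (at t)"
    "(gegenbauer_potential m N has_real_derivative
      2 * (real m * (real m - 1)) * cos t / sin t ^ 3) (at t)"
    by (rule DERIV_weighted_gegenbauer DERIV_weighted_gegenbauer' DERIV_gegenbauer_potential)+
  show "2 * (real m * (real m - 1)) * cos t / sin t ^ 3 \<ge> 0"
    using pos[OF t] cos_ge_zero[of t] t assms(1) by simp
qed (use assms in \<open>auto simp: weighted_gegenbauer_def weighted_gegenbauer'_def
      gegenbauer'_half_pi cot_def\<close>)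

lemma abs_weighted_gegenbauer_minus: "\<bar>weighted_gegenbauer m N (- t)\<bar> = \<bar>weighted_gegenbauer m N t\<bar>"
  by (simp add: weighted_gegenbauer_def gegenbauer_def abs_mult power_abs)

lemma abs_weighted_gegenbauer_le:
  assumes m: "m > 0" and t: "\<bar>t\<bar> \<le> pi/2"
  shows "\<bar>weighted_gegenbauer m (2 * M) t\<bar> \<le> (1 + pi/2 * real (2 * M + m)) * multichoose (real m) M"
proof -
  let ?y = "weighted_gegenbauer m (2 * M)"
  interpret increasing_oscillation ?y "weighted_gegenbauer' m (2 * M)"
    "gegenbauer_potential m (2 * M)"
    "\<lambda>t. 2 * (real m * (real m - 1)) * cos t / sin t ^ 3" "pi/2"
    by (rule increasing_oscillation_weighted_gegenbauer[OF m]) simp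
  have "gegenbauer_potential m (2 * M) (pi/2) \<le> (real (2 * M + m))\<^sup>2"
    using m by (simp add: gegenbauer_potential_def)
  then have "\<bar>?y \<bar>t\<bar>\<bar> \<le> (1 + pi/2 * real (2 * M + m)) * \<bar>?y (pi/2)\<bar>"
    using t by (intro abs_solution_le) auto
  moreover have "\<bar>?y \<bar>t\<bar>\<bar> = \<bar>?y t\<bar>" by (cases "t \<ge> 0") (auto simp: abs_weighted_gegenbauer_minus)
  moreover have "\<bar>?y (pi/2)\<bar> = multichoose (real m) M"
    using abs_gegenbauer_half_pi by (simp add: weighted_gegenbauer_def)
  ultimately show ?thesis by simp
qed

section \<open>Sharpness\<close>

definition extremal_poly :: "nat \<Rightarrow> nat \<Rightarrow> complex poly" where
  "extremal_poly m M =
     [:-1, 1:] ^ m * (\<Sum>k\<le>2 * M. monom (of_real (gegenbauer_coeff (real m) (2 * M) k)) k)"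

lemma sum_gegenbauer_coeff_cis:
  "(\<Sum>k\<le>N. of_real (gegenbauer_coeff a N k) * cis (2 * t) ^ k) =
     cis (real N * t) * of_real (gegenbauer a N t)"
proof -
  let ?c = "gegenbauer_coeff a N" and ?j = "gegenbauer_freq N"
  have "(\<Sum>k\<le>N. ?c k * sin (?j k * t)) = (\<Sum>k\<le>N. ?c (N - k) * sin (?j (N - k) * t))"
    by (rule sum.reindex_bij_witness[of _ "\<lambda>k. N - k" "\<lambda>k. N - k"]) auto
  also have "\<dots> = (\<Sum>k\<le>N. - (?c k * sin (?j k * t)))"
  proof (intro sum.cong refl)
    fix k assume "k \<in> {..N}"
    then have "?j (N - k) * t = - (?j k * t)" "?c (N - k) = ?c k"
      by (auto simp: gegenbauer_freq_def gegenbauer_coeff_reflect algebra_simps of_nat_diff)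
    then show "?c (N - k) * sin (?j (N - k) * t) = - (?c k * sin (?j k * t))" by simp
  qed
  finally have "(\<Sum>k\<le>N. ?c k * sin (?j k * t)) = 0" by (simp add: sum_negf)
  then have "(\<Sum>k\<le>N. of_real (?c k) * cis (- (?j k * t))) = of_real (gegenbauer a N t)"
    by (simp add: complex_eq_iff gegenbauer_def sum_negf)
  moreover have "cis (2 * t) ^ k = cis (real N * t) * cis (- (?j k * t))" for k
    unfolding Complex.DeMoivre cis_mult by (simp add: gegenbauer_freq_def algebra_simps)
  then have "(\<Sum>k\<le>N. of_real (?c k) * cis (2 * t) ^ k) =
      cis (real N * t) * (\<Sum>k\<le>N. of_real (?c k) * cis (- (?j k * t)))"
    by (simp add: sum_distrib_left mult_ac)
  ultimately show ?thesis by simp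
qed

lemma norm_poly_extremal_poly_cis:
  "norm (poly (extremal_poly m M) (cis (2 * t))) = 2 ^ m * \<bar>weighted_gegenbauer m (2 * M) t\<bar>"
proof -
  have "norm (cis (2 * t) - 1) = 2 * \<bar>sin t\<bar>"
    unfolding norm_minus_commute[of _ 1] one_minus_cis by (simp add: norm_mult)
  then have "norm ((cis (2 * t) - 1) ^ m) = 2 ^ m * \<bar>sin t\<bar> ^ m"
    by (simp add: norm_power power_mult_distrib)
  moreover have "poly (extremal_poly m M) (cis (2 * t)) =
      (cis (2 * t) - 1) ^ m * (cis (real (2 * M) * t) * of_real (gegenbauer (real m) (2 * M) t))"
    by (simp add: extremal_poly_def poly_sum poly_monom sum_gegenbauer_coeff_cis)
  ultimately show ?thesis
    by (simp add: norm_mult weighted_gegenbauer_def abs_mult power_abs)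
qed

lemma norm_poly_extremal_poly_le:
  assumes "m > 0" and z: "norm z = 1"
  shows "norm (poly (extremal_poly m M) z) \<le>
    2 ^ m * ((1 + pi/2 * real (2 * M + m)) * multichoose (real m) M)"
proof -
  have "cis (2 * (Arg z / 2)) = z" using cis_Arg_unit[OF z] by simp
  moreover have "\<bar>Arg z / 2\<bar> \<le> pi/2" using mpi_less_Arg[of z] Arg_le_pi[of z] by auto
  ultimately show ?thesis
    using abs_weighted_gegenbauer_le[OF assms(1), of "Arg z / 2" M]
      norm_poly_extremal_poly_cis[of m M "Arg z / 2"] by simp
qed

context
  fixes m M :: nat
  assumes m: "m > 0"
begin

lemma
  shows degree_extremal_poly: "degree (extremal_poly m M) = 2 * M + m"
    and lead_coeff_extremal_poly:
      "lead_coeff (extremal_poly m M) = of_real (multichoose (real m) (2 * M))"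
    and norm_coeff_0_extremal_poly:
      "norm (coeff (extremal_poly m M) 0) = multichoose (real m) (2 * M)"
proof -
  define q :: "complex poly" where
    "q = (\<Sum>k\<le>2 * M. monom (of_real (gegenbauer_coeff (real m) (2 * M) k)) k)"
  have coeff_q:
    "coeff q i = (if i \<le> 2 * M then of_real (gegenbauer_coeff (real m) (2 * M) i) else 0)" for i
    by (simp add: q_def coeff_sum)
  then have ends: "coeff q (2 * M) = of_real (multichoose (real m) (2 * M))"
      "coeff q 0 = of_real (multichoose (real m) (2 * M))"
    by (simp_all add: gegenbauer_coeff_def)
  have pos: "multichoose (real m) (2 * M) > 0" using m by (simp add: multichoose_pos)
  have "degree q \<le> 2 * M" by (rule degree_le) (simp add: coeff_q)
  moreover have "2 * M \<le> degree q" by (rule le_degree) (use ends pos in simp)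
  ultimately have deg_q: "degree q = 2 * M" by simp
  have q_nonzero: "q \<noteq> 0" using ends pos by auto
  have poly: "extremal_poly m M = [:-1, 1:] ^ m * q" by (simp only: extremal_poly_def q_def)
  show "degree (extremal_poly m M) = 2 * M + m"
    unfolding poly using q_nonzero by (subst degree_mult_eq) (auto simp: degree_power_eq deg_q)
  show "lead_coeff (extremal_poly m M) = of_real (multichoose (real m) (2 * M))"
    unfolding poly lead_coeff_mult lead_coeff_power deg_q ends by simp
  show "norm (coeff (extremal_poly m M) 0) = multichoose (real m) (2 * M)"
    unfolding poly coeff_mult_0 coeff_0_power norm_mult norm_power ends using pos by simp
qed

lemma extremal_poly_admissible: "degree (extremal_poly m M) \<ge> 1" "poly (extremal_poly m M) 0 \<noteq> 0"
  using m norm_coeff_0_extremal_poly multichoose_pos[of "real m" "2 * M"]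
  by (auto simp: degree_extremal_poly poly_0_coeff_0)

lemma height_extremal_poly_le:
  assumes M: "M > 0"
  defines "n \<equiv> real (2 * M + m)"
  shows "height (extremal_poly m M) \<le> (ln (2 + pi * n) + real m * (real m - 1) / (4 * real M)) / n"
proof -
  let ?f = "extremal_poly m M" and ?e = "real m * (real m - 1) / (4 * real M)"
  have n_pos: "n > 0" using m by (simp add: n_def)
  have pos: "multichoose (real m) (2 * M) > 0" using m by (simp add: multichoose_pos)
  have "Sup ((\<lambda>z. norm (poly ?f z)) ` sphere 0 1) \<le>
      2 ^ m * ((1 + pi/2 * n) * multichoose (real m) M)"
    unfolding n_def by (rule cSUP_least) (use norm_poly_extremal_poly_le[OF m] in auto)
  moreover have "sqrt (norm (coeff ?f 0 * lead_coeff ?f)) = multichoose (real m) (2 * M)"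
    unfolding norm_mult norm_coeff_0_extremal_poly lead_coeff_extremal_poly using pos by simp
  ultimately have "normalized_max ?f \<le>
      2 ^ m * ((1 + pi/2 * n) * multichoose (real m) M) / multichoose (real m) (2 * M)"
    unfolding normalized_max_def using pos by (simp add: divide_right_mono)
  also have "\<dots> = (1 + pi/2 * n) * (2 ^ m * multichoose (real m) M / multichoose (real m) (2 * M))"
    by simp
  also have "\<dots> \<le> (1 + pi/2 * n) * (2 * exp ?e)"
    using n_pos by (intro mult_left_mono multichoose_ratio_le m M) auto
  also have "\<dots> = (2 + pi * n) * exp ?e" by (simp add: algebra_simps)
  finally have "ln (normalized_max ?f) \<le> ln ((2 + pi * n) * exp ?e)"
    using normalized_max_ge_1[OF extremal_poly_admissible] by (intro ln_mono) auto
  also have "\<dots> = ln (2 + pi * n) + ?e"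
  proof -
    have "2 + pi * n > 0" using n_pos by (simp add: add_pos_pos)
    then show ?thesis by (simp add: ln_mult)
  qed
  finally show ?thesis
    unfolding height_eq degree_extremal_poly n_def by (rule divide_right_mono) simp
qed

lemma discrepancy_extremal_poly_ge: "real m / real (2 * M + m) \<le> discrepancy (extremal_poly m M)"
proof -
  let ?f = "extremal_poly m M"
  have f_nonzero: "?f \<noteq> 0" using extremal_poly_admissible by auto
  have "[:-1, 1:] ^ m dvd ?f" by (simp only: extremal_poly_def dvd_triv_left)
  then have "m \<le> order 1 ?f" using f_nonzero order_divides[of 1 m ?f] by blast
  also have "order 1 ?f = size (filter_mset (\<lambda>z. z = 1) (proots ?f))"
    using f_nonzero by (simp flip: count_conv_size_mset)
  also have "\<dots> \<le> root_count ?f 0 0"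
    unfolding root_count_eq_size[OF f_nonzero]
    by (intro size_mset_mono filter_mset_mono_strong subset_mset.order_refl)
       (simp add: on_arc_def angle_frac_def)
  finally have "real m / real (degree ?f) \<le> real (root_count ?f 0 0) / real (degree ?f)"
    by (intro divide_right_mono) auto
  also have "\<dots> \<le> discrepancy ?f" using discrepancy_ge[OF extremal_poly_admissible, of 0 0] by simp
  finally show ?thesis by (simp only: degree_extremal_poly)
qed

end

lemma extremal_height_bound_asymptotics:
  defines "n \<equiv> \<lambda>s. 2 * s ^ 4 + s ^ 3"
  defines "B \<equiv> \<lambda>s. (ln (2 + pi * n s) + s ^ 3 * (s ^ 3 - 1) / (4 * s ^ 4)) / n s"
  assumes "C < sqrt 2"
  shows "eventually (\<lambda>s. C * sqrt (B (real s)) < real s ^ 3 / n (real s)) sequentially"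
proof -
  have "((\<lambda>s. (s ^ 3 / n s)\<^sup>2 / B s) \<longlongrightarrow> 2) at_top"
    unfolding n_def B_def power_divide by real_asymp
  then have "((\<lambda>s. sqrt ((s ^ 3 / n s)\<^sup>2 / B s)) \<longlongrightarrow> sqrt 2) at_top"
    by (rule tendsto_real_sqrt)
  then have "eventually (\<lambda>s. C < sqrt ((s ^ 3 / n s)\<^sup>2 / B s)) at_top"
    using assms(3) by (rule order_tendstoD(1))
  moreover have "eventually (\<lambda>s. B s > 0) at_top" "eventually (\<lambda>s. s ^ 3 / n s > 0) at_top"
    unfolding n_def B_def by real_asymp+
  ultimately have "eventually (\<lambda>s. C * sqrt (B s) < s ^ 3 / n s) at_top"
    by eventually_elim
      (simp only: real_sqrt_divide real_sqrt_abs abs_of_pos pos_less_divide_eq real_sqrt_gt_zero)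
  then show ?thesis
    by (rule eventually_compose_filterlim[OF _ filterlim_real_sequentially])
qed

lemma sqrt_2_sharp:
  assumes "c < sqrt 2"
  obtains f :: "complex poly" where "degree f \<ge> 1" "poly f 0 \<noteq> 0"
    "discrepancy f > c * sqrt (height f)"
proof -
  define n where "n s = 2 * s ^ 4 + s ^ 3" for s :: real
  define B where "B s = (ln (2 + pi * n s) + s ^ 3 * (s ^ 3 - 1) / (4 * s ^ 4)) / n s" for s :: real
  have "eventually (\<lambda>s. max c 0 * sqrt (B (real s)) < real s ^ 3 / n (real s)) sequentially"
    using extremal_height_bound_asymptotics[of "max c 0"] assms unfolding n_def B_def
    by (auto elim: eventually_mono)
  then have "eventually (\<lambda>s. max c 0 * sqrt (B (real s)) < real s ^ 3 / n (real s) \<and> s > 0)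
    sequentially"
    using eventually_gt_at_top by (rule eventually_conj)
  then obtain s :: nat where s_bound: "max c 0 * sqrt (B (real s)) < real s ^ 3 / n (real s)" "s > 0"
    by (auto simp: eventually_sequentially)
  define f where "f = extremal_poly (s ^ 3) (s ^ 4)"
  have cube_pos: "s ^ 3 > 0" and fourth_pos: "s ^ 4 > 0" using s_bound(2) by simp_all
  have degree_eq: "real (2 * s ^ 4 + s ^ 3) = n (real s)" by (simp add: n_def)
  have "height f \<le> B (real s)"
    using height_extremal_poly_le[OF cube_pos fourth_pos]
    unfolding f_def degree_eq by (simp add: B_def)
  then have "c * sqrt (height f) \<le> max c 0 * sqrt (B (real s))"
    using height_nonneg[OF extremal_poly_admissible[OF cube_pos]]
    by (intro mult_mono) (auto simp: f_def)
  also note s_bound(1)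
  also have "real s ^ 3 / n (real s) \<le> discrepancy f"
    using discrepancy_extremal_poly_ge[OF cube_pos, of "s ^ 4"] unfolding f_def degree_eq by simp
  finally show ?thesis
    using extremal_poly_admissible[OF cube_pos] unfolding f_def by (intro that)
qed

theorem theorem1p1:
  shows "(\<forall>f :: complex poly. degree f \<ge> 1 \<and> poly f 0 \<noteq> 0 \<longrightarrow>
            discrepancy f \<le> sqrt 2 * sqrt (height f))
       \<and> (\<forall>c :: real. c < sqrt 2 \<longrightarrow>
            (\<exists>f :: complex poly. degree f \<ge> 1 \<and> poly f 0 \<noteq> 0 \<and>
               discrepancy f > c * sqrt (height f)))"
  using discrepancy_le_sqrt_height sqrt_2_sharp by metis

end
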